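(* Let $\mathfrak A$ be a unital JB-algebra and let $S_2$ be a Lie-Trotter mean in $\mathfrak A$ (i.e. a weighted 2-mean $S_2(1-\lambda,\lambda;\cdot)$, $\lambda\in(0,1)$, that is a two-variable Lie-Trotter mean). Then for every $n\ge2$ the associated Sagae-Tanabe mean $S_n$ is a multivariate Lie-Trotter mean.
   Context: A (real) Jordan algebra is a real vector space $\mathfrak A$ with a bilinear product $\circ$ satisfying $A\circ B=B\circ A$ and $(A^2\circ B)\circ A=A^2\circ(B\circ A)$, where $A^2=A\circ A$. A JB-algebra is a Jordan algebra over $\mathbb R$ with a complete norm such that $\|A\circ B\|\le\|A\|\|B\|$, $\|A^2\|=\|A\|^2$ and $\|A^2\|\le\|A^2+B^2\|$. In a unital JB-algebra with unit $I$, $A$ is invertible with (Jordan) inverse $B=A^{-1}$ if $A\circ B=I$ and $A^2\circ B=A$; the spectrum of $A$ is $\{\lambda\in\mathbb R: A-\lambda I \text{ is not invertible}\}$; $A$ is positive if its spectrum lies in $[0,\infty)$. $\mathfrak A_{++}$ is the open convex cone of positive invertible elements. Real powers, $\exp$ and $\log$ are given by functional calculus in $\mathfrak A$. $\Delta_n$ denotes the set of probability vectors $\omega=(\omega_1,\dots,\omega_n)$ in $\mathbb R^n$ with all $\omega_k>0$. A weighted 2-mean is, for weights $\lambda\in(0,1)$, a map $G_2(1-\lambda,\lambda;\cdot):\mathfrak A_{++}^2\to\mathfrak A_{++}$ with $G_2(1-\lambda,\lambda;A,A)=A$ for all $A\in\mathfrak A_{++}$. It is a two-variable Lie-Trotter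 mean if it is differentiable and $\lim_{t\to0}G_2(1-\lambda,\lambda;\gamma_1(t),\gamma_2(t))^{1/t}=\exp[(1-\lambda)\gamma_1'(0)+\lambda\gamma_2'(0)]$ for all differentiable curves $\gamma_1,\gamma_2:(-\varepsilon,\varepsilon)\to\mathfrak A_{++}$ with $\gamma_1(0)=\gamma_2(0)=I$. Here $S_2$ is given for all weights $\lambda\in(0,1)$ and has these properties for each of them. A weighted $n$-mean ($n\ge2$, $\omega\in\Delta_n$) is a map $G_n(\omega;\cdot):\mathfrak A_{++}^n\to\mathfrak A_{++}$ with $G_n(\omega;A,\dots,A)=A$ for all $A\in\mathfrak A_{++}$. It is a multivariate Lie-Trotter mean if $\lim_{t\to0}G_n(\omega;\gamma_1(t),\dots,\gamma_n(t))^{1/t}=\exp\left(\sum_{k=1}^n\omega_k\gamma_k'(0)\right)$ for all differentiable curves $\gamma_k:(-\varepsilon,\varepsilon)\to\mathfrak A_{++}$ with $\gamma_k(0)=I$, $1\le k\le n$. Sagae-Tanabe mean associated with $S_2$: for $n\ge3$, $\omega\in\Delta_n$ and $A_1,\dots,A_n\in\mathfrak A_{++}$, inductively $$S_n(\omega;A_1,\dots,A_n)=S_2\left(1-\omega_n,\omega_n;\,S_{n-1}(\hat\omega;A_1,\dots,A_{n-1}),A_n\right),\qquad \hat\omega=\tfrac1{1-\omega_n}(\omega_1,\dots,\omega_{n-1})\in\Delta_{n-1}.$$ *)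

theory Defs
  imports "HOL-Analysis.Analysis" "HOL-Computational_Algebra.Polynomial"
begin

class jordan_algebra = real_vector +
  fixes jprod :: "'a \<Rightarrow> 'a \<Rightarrow> 'a"  (infixl "\<odot>" 70)
  assumes jprod_add_left: "(a + b) \<odot> c = a \<odot> c + b \<odot> c"
    and jprod_scaleR_left: "scaleR r a \<odot> b = scaleR r (a \<odot> b)"
    and jprod_commute: "a \<odot> b = b \<odot> a"
    and jordan_identity: "((a \<odot> a) \<odot> b) \<odot> a = (a \<odot> a) \<odot> (b \<odot> a)"

class jb_algebra = jordan_algebra + banach +
  assumes norm_jprod_le: "norm (a \<odot> b) \<le> norm a * norm b"
    and norm_jsquare: "norm (a \<odot> a) = (norm a)\<^sup>2"
    and norm_jsquare_le_add: "norm (a \<odot> a) \<le> norm (a \<odot> a + b \<odot> b)"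

class unital_jb_algebra = jb_algebra + one +
  assumes jprod_one_left: "1 \<odot> a = a"

definition jinvertible :: "'a::unital_jb_algebra \<Rightarrow> bool" where
  "jinvertible A \<longleftrightarrow> (\<exists>B. A \<odot> B = 1 \<and> (A \<odot> A) \<odot> B = A)"

definition jspectrum :: "'a::unital_jb_algebra \<Rightarrow> real set" where
  "jspectrum A = {l. \<not> jinvertible (A - l *\<^sub>R 1)}"

definition jpositive :: "'a::unital_jb_algebra \<Rightarrow> bool" where
  "jpositive A \<longleftrightarrow> jspectrum A \<subseteq> {0..}"

definition pos_cone :: "'a::unital_jb_algebra set" where
  "pos_cone = {A. jpositive A \<and> jinvertible A}"

primrec jpow :: "'a::unital_jb_algebra \<Rightarrow> nat \<Rightarrow> 'a" where
  "jpow A 0 = 1"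
| "jpow A (Suc n) = A \<odot> jpow A n"

definition jpoly :: "real poly \<Rightarrow> 'a::unital_jb_algebra \<Rightarrow> 'a" where
  "jpoly p A = (\<Sum>i\<le>degree p. coeff p i *\<^sub>R jpow A i)"

text \<open>
  Continuous functional calculus: for \<open>f\<close> continuous on the (compact) spectrum of \<open>A\<close>, the
  element \<open>f(A)\<close> is the common limit of \<open>p\<^sub>n(A)\<close> over all sequences of real polynomials
  \<open>p\<^sub>n\<close> converging to \<open>f\<close> uniformly on the spectrum. This is the image of \<open>f\<close> under the
  isometric isomorphism from \<open>C(sp A)\<close> onto the closed subalgebra generated by \<open>A\<close> and \<open>1\<close>
  that extends \<open>p \<mapsto> p(A)\<close>. The value is meaningful only for \<open>f\<close> continuous on the spectrum.
\<close>

definition jfun :: "(real \<Rightarrow> real) \<Rightarrow> 'a::unital_jb_algebra \<Rightarrow> 'a" where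
  "jfun f A = (THE B. \<forall>p. uniform_limit (jspectrum A) (\<lambda>n. poly (p n)) f sequentially
                        \<longrightarrow> (\<lambda>n. jpoly (p n) A) \<longlonglongrightarrow> B)"

definition jexp :: "'a::unital_jb_algebra \<Rightarrow> 'a" where
  "jexp A = jfun exp A"

text \<open>Real powers; used for \<open>A \<in> pos_cone\<close>, whose spectrum lies in the open half-line.\<close>

definition jpowr :: "'a::unital_jb_algebra \<Rightarrow> real \<Rightarrow> 'a" where
  "jpowr A r = jfun (\<lambda>x. x powr r) A"

definition cone_curve :: "real \<Rightarrow> (real \<Rightarrow> 'a::unital_jb_algebra) \<Rightarrow> bool" where
  "cone_curve \<epsilon> \<gamma> \<longleftrightarrow>
     (\<forall>t\<in>{-\<epsilon><..<\<epsilon>}. \<gamma> t \<in> pos_cone) \<and> \<gamma> differentiable_on {-\<epsilon><..<\<epsilon>} \<and> \<gamma> 0 = 1"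

text \<open>In a weighted 2-mean \<open>G\<close>, the first two arguments are the weights \<open>1 - \<lambda>\<close> and \<open>\<lambda>\<close>.\<close>

definition weighted_2mean :: "(real \<Rightarrow> real \<Rightarrow> 'a::unital_jb_algebra \<Rightarrow> 'a \<Rightarrow> 'a) \<Rightarrow> bool" where
  "weighted_2mean G \<longleftrightarrow> (\<forall>l\<in>{0<..<1}.
     (\<forall>A\<in>pos_cone. \<forall>B\<in>pos_cone. G (1 - l) l A B \<in> pos_cone) \<and>
     (\<forall>A\<in>pos_cone. G (1 - l) l A A = A))"

text \<open>Differentiability is in the Frechet sense, jointly in both arguments for fixed weights.\<close>

definition lie_trotter_2mean :: "(real \<Rightarrow> real \<Rightarrow> 'a::unital_jb_algebra \<Rightarrow> 'a \<Rightarrow> 'a) \<Rightarrow> bool" where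
  "lie_trotter_2mean G \<longleftrightarrow> weighted_2mean G \<and> (\<forall>l\<in>{0<..<1}.
     (\<lambda>(A, B). G (1 - l) l A B) differentiable_on (pos_cone \<times> pos_cone) \<and>
     (\<forall>\<epsilon>>0. \<forall>\<gamma>1 \<gamma>2. cone_curve \<epsilon> \<gamma>1 \<and> cone_curve \<epsilon> \<gamma>2 \<longrightarrow>
        ((\<lambda>t. jpowr (G (1 - l) l (\<gamma>1 t) (\<gamma>2 t)) (1 / t)) \<longlongrightarrow>
           jexp ((1 - l) *\<^sub>R vector_derivative \<gamma>1 (at 0) + l *\<^sub>R vector_derivative \<gamma>2 (at 0))) (at 0)))"

text \<open>
  An \<open>n\<close>-tuple is represented by a function on \<open>nat\<close> of which only the values at
  \<open>1, \<dots>, n\<close> are relevant.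
\<close>

definition prob_simplex :: "nat \<Rightarrow> (nat \<Rightarrow> real) set" where
  "prob_simplex n = {\<omega>. (\<forall>k\<in>{1..n}. 0 < \<omega> k) \<and> (\<Sum>k=1..n. \<omega> k) = 1}"

text \<open>The first conjunct says that \<open>G\<close> is a function of the \<open>n\<close>-tuples of weights and points.\<close>

definition weighted_mean ::
  "nat \<Rightarrow> ((nat \<Rightarrow> real) \<Rightarrow> (nat \<Rightarrow> 'a::unital_jb_algebra) \<Rightarrow> 'a) \<Rightarrow> bool" where
  "weighted_mean n G \<longleftrightarrow>
     (\<forall>\<omega> \<omega>' A A'. (\<forall>k\<in>{1..n}. \<omega> k = \<omega>' k \<and> A k = A' k) \<longrightarrow> G \<omega> A = G \<omega>' A') \<and>
     (\<forall>\<omega>\<in>prob_simplex n.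
        (\<forall>A. (\<forall>k\<in>{1..n}. A k \<in> pos_cone) \<longrightarrow> G \<omega> A \<in> pos_cone) \<and>
        (\<forall>A\<in>pos_cone. G \<omega> (\<lambda>k. A) = A))"

definition lie_trotter_mean ::
  "nat \<Rightarrow> ((nat \<Rightarrow> real) \<Rightarrow> (nat \<Rightarrow> 'a::unital_jb_algebra) \<Rightarrow> 'a) \<Rightarrow> bool" where
  "lie_trotter_mean n G \<longleftrightarrow> weighted_mean n G \<and> (\<forall>\<omega>\<in>prob_simplex n.
     \<forall>\<epsilon>>0. \<forall>\<gamma>. (\<forall>k\<in>{1..n}. cone_curve \<epsilon> (\<gamma> k)) \<longrightarrow>
       ((\<lambda>t. jpowr (G \<omega> (\<lambda>k. \<gamma> k t)) (1 / t)) \<longlongrightarrow>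
          jexp (\<Sum>k=1..n. \<omega> k *\<^sub>R vector_derivative (\<gamma> k) (at 0))) (at 0))"

text \<open>Meaningful for \<open>n \<ge> 2\<close>; on \<open>prob_simplex 2\<close> the first weight is \<open>1 - \<omega> 2\<close>.\<close>

fun sagae_tanabe ::
  "(real \<Rightarrow> real \<Rightarrow> 'a \<Rightarrow> 'a \<Rightarrow> 'a) \<Rightarrow> nat \<Rightarrow> (nat \<Rightarrow> real) \<Rightarrow> (nat \<Rightarrow> 'a) \<Rightarrow> 'a" where
  "sagae_tanabe S n \<omega> A =
     (if n \<le> 2 then S (\<omega> 1) (\<omega> 2) (A 1) (A 2)
      else S (1 - \<omega> n) (\<omega> n) (sagae_tanabe S (n - 1) (\<lambda>k. \<omega> k / (1 - \<omega> n)) A) (A n))"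

declare sagae_tanabe.simps [simp del]

end

theory Submission
  imports Defs "HOL-Computational_Algebra.Fundamental_Theorem_Algebra"
begin

text \<open>
  The heart of the matter is that the Lie-Trotter property is a statement about first derivatives.
  For any differentiable curve \<open>g\<close> with \<open>g 0 = 1\<close>, the roots \<open>(g t)\<^sup>1\<^sup>/\<^sup>t\<close> tend to
  \<open>exp (g' 0)\<close> (lemma \<open>tendsto_jpowr_curve\<close>), and \<open>exp\<close> is injective on the algebra
  (lemma \<open>jexp_inj\<close>). Let \<open>S\<^sub>2\<close> be a two-variable Lie-Trotter mean and \<open>g\<^sub>1\<close>, \<open>g\<^sub>2\<close> curves in
  the cone through the unit. Then \<open>h = S\<^sub>2(1 - l, l; g\<^sub>1, g\<^sub>2)\<close> is again such a curve, and
  \<open>(h t)\<^sup>1\<^sup>/\<^sup>t\<close> has the two limits \<open>exp (h' 0)\<close> and \<open>exp ((1 - l) g\<^sub>1' 0 + l g\<^sub>2' 0)\<close>. Hence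
  \<open>h' 0 = (1 - l) g\<^sub>1' 0 + l g\<^sub>2' 0\<close>. This formula passes through the recursion that defines the
  Sagae-Tanabe mean \<open>S\<^sub>n\<close>: along \<open>n\<close> curves its derivative at \<open>0\<close> is the weighted sum of their
  derivatives, and the limit of the roots is read off from it.

  Both facts about \<open>exp\<close> and the roots come from the continuous functional calculus of a single
  element \<open>A\<close>, which rests on the estimate \<open>norm (p(A)) \<le> sup \<bar>p\<bar>\<close> over the spectrum, for real
  polynomials \<open>p\<close> (lemma \<open>norm_jpoly_le\<close>). The linearized Jordan identity makes \<open>p \<mapsto> p(A)\<close>
  multiplicative, so \<open>N p = norm (p(A))\<close> is a seminorm on the ring of real polynomials that
  inherits \<open>N (p\<^sup>2) = (N p)\<^sup>2 \<le> N (p\<^sup>2 + q\<^sup>2)\<close>. If \<open>q \<noteq> 0\<close> has no zero on the spectrum, then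
  multiplication by \<open>q\<close> is bounded below for \<open>N\<close>; this is checked on the linear and the irreducible
  quadratic factors of \<open>q\<close>. On the other hand, if \<open>N x = 1\<close> then multiplication by \<open>1 - x\<^sup>2\<close> is not
  bounded below, since
  \<open>(1 - x\<^sup>2)(1 + x\<^sup>2)(1 + x\<^sup>4) \<cdots> = 1 - x\<^sup>2\<^sup>m\<close>, with \<open>m\<close> a power of \<open>2\<close>, stays bounded while the
  product of the other factors, which expands to a sum of \<open>m\<close> powers of \<open>x\<^sup>2\<close>, has norm at least \<open>m\<close>.
  Applied to \<open>x = p / N p\<close>, this forces \<open>\<bar>p\<bar>\<close> to take the value \<open>N p\<close> on the spectrum.
\<close>

section \<open>Polynomials in an element of a Jordan algebra\<close>

lemma jprod_add_right: "c \<odot> (a + b) = c \<odot> a + c \<odot> b" for a b c :: "'a::jordan_algebra"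
  by (metis jprod_add_left jprod_commute)

lemma jprod_scaleR_right: "a \<odot> scaleR r b = scaleR r (a \<odot> b)" for a b :: "'a::jordan_algebra"
  by (metis jprod_scaleR_left jprod_commute)

lemma jprod_one_right: "a \<odot> 1 = a" for a :: "'a::unital_jb_algebra"
  by (metis jprod_one_left jprod_commute)

lemma bounded_bilinear_jprod: "bounded_bilinear (jprod :: 'a::jb_algebra \<Rightarrow> 'a \<Rightarrow> 'a)"
  by (rule bounded_bilinear.intro)
     (auto simp: jprod_add_left jprod_add_right jprod_scaleR_left jprod_scaleR_right
       intro!: exI[of _ 1] norm_jprod_le)

lemma jprod_zero_left: "0 \<odot> a = 0" for a :: "'a::jb_algebra"
  by (rule bounded_bilinear.zero_left[OF bounded_bilinear_jprod])
lemma jprod_zero_right: "a \<odot> 0 = 0" for a :: "'a::jb_algebra"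
  by (rule bounded_bilinear.zero_right[OF bounded_bilinear_jprod])
lemma jprod_minus_left: "(- a) \<odot> b = - (a \<odot> b)" for a :: "'a::jb_algebra"
  by (rule bounded_bilinear.minus_left[OF bounded_bilinear_jprod])
lemma jprod_minus_right: "a \<odot> (- b) = - (a \<odot> b)" for a :: "'a::jb_algebra"
  by (rule bounded_bilinear.minus_right[OF bounded_bilinear_jprod])
lemma jprod_diff_left: "(a - b) \<odot> c = a \<odot> c - b \<odot> c" for a :: "'a::jb_algebra"
  by (rule bounded_bilinear.diff_left[OF bounded_bilinear_jprod])
lemma jprod_diff_right: "c \<odot> (a - b) = c \<odot> a - c \<odot> b" for a :: "'a::jb_algebra"
  by (rule bounded_bilinear.diff_right[OF bounded_bilinear_jprod])

lemmas jprod_linear = jprod_add_left jprod_add_right jprod_scaleR_left jprod_scaleR_right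
  jprod_zero_left jprod_zero_right jprod_minus_left jprod_minus_right jprod_diff_left jprod_diff_right
  jprod_one_left jprod_one_right

text \<open>
  The Jordan identity is cubic in one of its variables. Its defect at \<open>x + z\<close> minus its defect at
  \<open>x - z\<close> isolates, up to the defect at \<open>z\<close>, the terms of degree two in \<open>x\<close> and one in \<open>z\<close>.
  Below, the result is read as an identity between multiplication operators, acting on \<open>z\<close> or on \<open>b\<close>.
\<close>
lemma jordan_identity_linearized:
  fixes x z b :: "'a::jb_algebra"
  shows "2 *\<^sub>R (x \<odot> (b \<odot> (x \<odot> z))) + z \<odot> (b \<odot> (x \<odot> x))
       = 2 *\<^sub>R ((b \<odot> x) \<odot> (x \<odot> z)) + (x \<odot> x) \<odot> (b \<odot> z)"
proof -
  define F where "F a = ((a \<odot> a) \<odot> b) \<odot> a - (a \<odot> a) \<odot> (b \<odot> a)" for a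
  have F0: "F a = 0" for a unfolding F_def by (simp add: jordan_identity)
  define D where "D = 2 *\<^sub>R (((x \<odot> z) \<odot> b) \<odot> x) + ((x \<odot> x) \<odot> b) \<odot> z
       - 2 *\<^sub>R ((x \<odot> z) \<odot> (b \<odot> x)) - (x \<odot> x) \<odot> (b \<odot> z)"
  have zx: "z \<odot> x = x \<odot> z" by (rule jprod_commute)
  have "F (x + z) - F (x - z) = 2 *\<^sub>R D + 2 *\<^sub>R F z"
    unfolding F_def D_def
    by (simp add: jprod_linear zx algebra_simps scaleR_2)
  then have "D = 0" by (simp add: F0)
  then show ?thesis unfolding D_def
    by (simp add: jprod_commute algebra_simps)
qed

lemma jprod_square_commute: "(x \<odot> x) \<odot> (x \<odot> b) = x \<odot> ((x \<odot> x) \<odot> b)" for x b :: "'a::jb_algebra"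
  using jordan_identity[of x b] by (simp add: jprod_commute)

text \<open>
  Multiplication by \<open>A\<^sup>m\<^sup>+\<^sup>2\<close> is a polynomial expression in the multiplications by \<open>A\<close>, \<open>A\<^sup>2\<close>, \<open>A\<^sup>m\<close>
  and \<open>A\<^sup>m\<^sup>+\<^sup>1\<close>, so commutation with multiplication by \<open>A\<close> propagates from \<open>m\<close> and \<open>m + 1\<close> to \<open>m + 2\<close>.
\<close>
lemma jpow_operator_commute:
  fixes A :: "'a::unital_jb_algebra"
  shows "jpow A n \<odot> (A \<odot> v) = A \<odot> (jpow A n \<odot> v)"
proof (induction n arbitrary: v rule: less_induct)
  case (less n)
  show ?case
  proof (cases "n < 2")
    case True
    then have "n = 0 \<or> n = 1" by auto
    then show ?thesis by (auto simp: jprod_linear)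
  next
    case False
    then obtain m where m: "n = Suc (Suc m)" by (metis add_2_eq_Suc le_Suc_ex not_less)
    have pow: "(A \<odot> A) \<odot> jpow A k = jpow A (Suc (Suc k))" for k
    proof (induction k)
      case 0 then show ?case by (simp add: jprod_linear)
    next
      case (Suc k) then show ?case by (simp add: jprod_square_commute)
    qed
    (* Read the linearized identity, with x = A and b = A^m, as a formula for multiplication by A^(m+2). *)
    have op: "jpow A n \<odot> z = (A \<odot> A) \<odot> (jpow A m \<odot> z)
        + 2 *\<^sub>R (jpow A (Suc m) \<odot> (A \<odot> z)) - 2 *\<^sub>R (A \<odot> (jpow A m \<odot> (A \<odot> z)))" for z
      using jordan_identity_linearized[of A "jpow A m" z] pow[of m]
      by (simp add: m jprod_commute algebra_simps)
    have c0: "jpow A m \<odot> (A \<odot> w) = A \<odot> (jpow A m \<odot> w)"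
      and c1: "jpow A (Suc m) \<odot> (A \<odot> w) = A \<odot> (jpow A (Suc m) \<odot> w)" for w
      using less.IH[of m] less.IH[of "Suc m"] m by (simp_all del: jpow.simps)
    show ?thesis
      unfolding op c0 c1 jprod_square_commute by (simp only: jprod_linear)
  qed
qed

lemma jpoly_pCons: "jpoly (pCons c p) A = c *\<^sub>R 1 + A \<odot> jpoly p A"
proof -
  have *: "jpoly q A = (\<Sum>i\<le>n. coeff q i *\<^sub>R jpow A i)" if "degree q \<le> n" for q n
    unfolding jpoly_def using that
    by (intro sum.mono_neutral_left) (auto simp: coeff_eq_0)
  have "jpoly (pCons c p) A = (\<Sum>i\<le>Suc (degree p). coeff (pCons c p) i *\<^sub>R jpow A i)"
    by (intro * degree_pCons_le)
  also have "\<dots> = c *\<^sub>R 1 + (\<Sum>i\<le>degree p. A \<odot> (coeff p i *\<^sub>R jpow A i))"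
    by (simp only: sum.atMost_Suc_shift coeff_pCons_0 coeff_pCons_Suc jpow.simps jprod_linear)
  also have "(\<Sum>i\<le>degree p. A \<odot> (coeff p i *\<^sub>R jpow A i)) = A \<odot> jpoly p A"
    unfolding jpoly_def
    by (simp add: bounded_bilinear.sum_right[OF bounded_bilinear_jprod])
  finally show ?thesis .
qed

lemma jpoly_0: "jpoly 0 A = 0" by (simp add: jpoly_def)

lemma jpoly_1: "jpoly 1 A = 1" by (simp add: jpoly_def)

lemma jpoly_X: "jpoly [:0, 1:] A = A" by (simp add: jpoly_pCons jpoly_0 jprod_linear)

lemma jpoly_add: "jpoly (p + q) A = jpoly p A + jpoly q A"
  by (induction p q rule: poly_induct2)
     (simp_all add: jpoly_pCons jpoly_0 jprod_linear algebra_simps)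

lemma jpoly_smult: "jpoly (smult c p) A = c *\<^sub>R jpoly p A"
  by (induction p) (simp_all add: jpoly_pCons jpoly_0 jprod_linear algebra_simps)

lemma jpoly_minus: "jpoly (- p) A = - jpoly p A"
  using jpoly_smult[of "-1" p A] by simp

lemma jpoly_diff: "jpoly (p - q) A = jpoly p A - jpoly q A"
  using jpoly_add[of p "- q" A] by (simp add: jpoly_minus)

lemma jpoly_operator_commute: "jpoly p A \<odot> (A \<odot> v) = A \<odot> (jpoly p A \<odot> v)"
  unfolding jpoly_def
  by (simp add: bounded_bilinear.sum_left[OF bounded_bilinear_jprod]
      bounded_bilinear.sum_right[OF bounded_bilinear_jprod] jprod_linear jpow_operator_commute)

text \<open>
  Power associativity: since multiplication by any polynomial in \<open>A\<close> commutes with multiplication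
  by \<open>A\<close>, a factor \<open>A\<close> can be moved out of either side of a product of two polynomials in \<open>A\<close>.
\<close>
lemma jpoly_mult: "jpoly (p * q) A = jpoly p A \<odot> jpoly q A"
proof (induction p)
  case 0 then show ?case by (simp add: jpoly_0 jprod_linear)
next
  case (pCons c p)
  have "jpoly p A \<odot> (A \<odot> jpoly q A) = A \<odot> (jpoly p A \<odot> jpoly q A)"
    by (rule jpoly_operator_commute)
  moreover have "jpoly q A \<odot> (A \<odot> jpoly p A) = A \<odot> (jpoly q A \<odot> jpoly p A)"
    by (rule jpoly_operator_commute)
  ultimately show ?case using pCons
    by (simp add: jpoly_pCons jpoly_add jpoly_smult jprod_linear jprod_commute)
qed

lemma jpoly_pcompose: "jpoly (pcompose p q) A = jpoly p (jpoly q A)"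
  by (induction p)
     (simp_all add: pcompose_pCons jpoly_pCons jpoly_0 jpoly_add jpoly_mult jprod_linear)

section \<open>The norm of a polynomial in an element is attained on the spectrum\<close>

text \<open>
  With \<open>x = [:- a, 1:]\<close>, the identity \<open>(x\<^sup>2 + b\<^sup>2)\<^sup>2 = (x\<^sup>2 - b\<^sup>2)\<^sup>2 + (2bx)\<^sup>2\<close> and monotonicity of the
  norm on sums of squares show that \<open>(x\<^sup>2 - b\<^sup>2)v\<close> is no larger than \<open>(x\<^sup>2 + b\<^sup>2)v\<close>; their difference
  is \<open>2b\<^sup>2v\<close>.
\<close>
lemma jpoly_quadratic_lower_bound:
  fixes A :: "'a::unital_jb_algebra"
  shows "b\<^sup>2 * norm (jpoly v A) \<le> norm (jpoly (([:- a, 1:]\<^sup>2 + [:b\<^sup>2:]) * v) A)"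
proof -
  define x where "x = [:- a, 1:]"
  define L where "L = norm (jpoly ((x\<^sup>2 + [:b\<^sup>2:]) * v) A)"
  define P where "P = jpoly ((x\<^sup>2 - [:b\<^sup>2:]) * v) A"
  define Q where "Q = jpoly (smult (2 * b) x * v) A"
  have "((x\<^sup>2 + [:b\<^sup>2:]) * v) * ((x\<^sup>2 + [:b\<^sup>2:]) * v)
      = ((x\<^sup>2 - [:b\<^sup>2:]) * v) * ((x\<^sup>2 - [:b\<^sup>2:]) * v) + (smult (2 * b) x * v) * (smult (2 * b) x * v)"
  proof -
    have "smult (2 * b) x = [:2:] * [:b:] * x" by (simp add: mult.commute)
    moreover have "[:b\<^sup>2:] = [:b:]\<^sup>2" by (simp add: power2_eq_square)
    moreover have "[:2:] = (2::real poly)" by (simp add: numeral_poly)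
    ultimately show ?thesis by algebra
  qed
  then have "L\<^sup>2 = norm (P \<odot> P + Q \<odot> Q)"
    unfolding L_def P_def Q_def by (metis norm_jsquare jpoly_mult jpoly_add)
  then have "(norm P)\<^sup>2 \<le> L\<^sup>2" using norm_jsquare_le_add[of P Q] by (simp add: norm_jsquare)
  then have "norm P \<le> L" unfolding L_def by (rule power2_le_imp_le) simp
  have "jpoly ((x\<^sup>2 + [:b\<^sup>2:]) * v) A - P = 2 *\<^sub>R (b\<^sup>2 *\<^sub>R jpoly v A)"
  proof -
    have "(x\<^sup>2 + [:b\<^sup>2:]) * v - (x\<^sup>2 - [:b\<^sup>2:]) * v = smult 2 (smult (b\<^sup>2) v)"
      by (simp add: algebra_simps flip: smult_add_left)
    then show ?thesis unfolding P_def by (simp flip: jpoly_diff jpoly_smult)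
  qed
  then have "2 * (b\<^sup>2 * norm (jpoly v A)) \<le> L + norm P"
    unfolding L_def by (metis abs_numeral norm_scaleR norm_triangle_ineq4 abs_power2)
  with \<open>norm P \<le> L\<close> show ?thesis unfolding L_def x_def by simp
qed

text \<open>
  Let \<open>a = A - l\<close> with Jordan inverse \<open>B\<close>. The definition of \<open>B\<close> does not say that \<open>B\<close> is a limit of
  polynomials in \<open>A\<close>, but the linearized Jordan identity shows that multiplication by \<open>B\<^sup>2\<close> commutes
  with multiplication by \<open>a\<close> and that \<open>B\<^sup>2a\<^sup>2 = 1\<close>. Hence multiplication by \<open>B\<^sup>2\<close> is a bounded left
  inverse of multiplication by \<open>a\<^sup>2\<close> on polynomials in \<open>A\<close>.
\<close>
lemma jpoly_linear_lower_bound: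
  fixes A :: "'a::unital_jb_algebra"
  assumes "l \<notin> jspectrum A"
  shows "\<exists>k>0. \<forall>v. k * norm (jpoly v A) \<le> norm (jpoly ([:- l, 1:] * v) A)"
proof -
  define x where "x = [:- l, 1:]"
  define a where "a = A - l *\<^sub>R 1"
  have ax: "jpoly x A = a"
    unfolding x_def a_def by (simp add: jpoly_pCons jpoly_0 jprod_linear)
  from assms obtain B where B: "a \<odot> B = 1" "(a \<odot> a) \<odot> B = a"
    unfolding jspectrum_def jinvertible_def a_def by auto
  have comm: "(B \<odot> B) \<odot> (a \<odot> v) = a \<odot> ((B \<odot> B) \<odot> v)" for v
    using jordan_identity_linearized[of B v a] B(1) by (simp add: jprod_linear jprod_commute)
  have "2 *\<^sub>R (a \<odot> (B \<odot> (a \<odot> B))) + B \<odot> (B \<odot> (a \<odot> a)) = 2 *\<^sub>R ((B \<odot> a) \<odot> (a \<odot> B)) + (a \<odot> a) \<odot> (B \<odot> B)"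
    by (rule jordan_identity_linearized)
  then have one: "(B \<odot> B) \<odot> (a \<odot> a) = 1"
    using B by (simp add: jprod_linear jprod_commute scaleR_2)
  have commA: "(B \<odot> B) \<odot> (A \<odot> v) = A \<odot> ((B \<odot> B) \<odot> v)" for v
    using comm[of v] unfolding a_def by (simp add: jprod_linear)
  (* Induction on v starts from one and moves factors A past multiplication by the square of B. *)
  have inv: "(B \<odot> B) \<odot> jpoly (x * (x * v)) A = jpoly v A" for v
  proof (induction v)
    case 0 then show ?case by (simp add: jpoly_0 jprod_linear)
  next
    case (pCons c v)
    have "x * (x * pCons c v) = smult c (x * x) + [:0, 1:] * (x * (x * v))"
      by (simp add: algebra_simps)
    then have "jpoly (x * (x * pCons c v)) A = c *\<^sub>R (a \<odot> a) + A \<odot> jpoly (x * (x * v)) A"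
      by (simp only: jpoly_add jpoly_mult jpoly_smult ax jpoly_X)
    then show ?case using pCons one by (simp add: jprod_linear commA jpoly_pCons)
  qed
  (* Adding 1 keeps K positive in the trivial algebra. *)
  define K where "K = norm (B \<odot> B) * norm a + 1"
  have "K > 0" unfolding K_def by (simp add: add_nonneg_pos)
  have "norm (jpoly v A) \<le> K * norm (jpoly (x * v) A)" for v
  proof -
    have "norm (jpoly v A) = norm ((B \<odot> B) \<odot> (a \<odot> jpoly (x * v) A))"
      using inv[of v] by (metis jpoly_mult ax)
    also have "\<dots> \<le> norm (B \<odot> B) * (norm a * norm (jpoly (x * v) A))"
      by (meson norm_jprod_le order_trans mult_left_mono norm_ge_zero)
    also have "\<dots> \<le> K * norm (jpoly (x * v) A)"
      unfolding K_def by (simp add: algebra_simps)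
    finally show ?thesis .
  qed
  then show ?thesis unfolding x_def[symmetric] using \<open>K > 0\<close>
    by (intro exI[of _ "1 / K"]) (auto simp: field_simps)
qed

lemma real_poly_root_or_quadratic_factor:
  fixes q :: "real poly"
  assumes "degree q > 0"
  shows "(\<exists>l. poly q l = 0) \<or> (\<exists>a b v. b \<noteq> 0 \<and> q = ([:- a, 1:]\<^sup>2 + [:b\<^sup>2:]) * v)"
proof -
  (* Evaluation of a real polynomial at a complex number, a ring homomorphism. *)
  define ev where "ev p z = poly (map_poly complex_of_real p) z" for p z
  have ev_pCons: "ev (pCons c p) z = of_real c + z * ev p z" for c p z
    unfolding ev_def by (cases "c = 0 \<and> p = 0") (auto simp: map_poly_pCons)
  have ev_0: "ev 0 z = 0" for z by (simp add: ev_def)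
  have ev_add: "ev (p + r) z = ev p z + ev r z" for p r z
    by (induction p r rule: poly_induct2) (simp_all add: ev_0 ev_pCons algebra_simps)
  have ev_smult: "ev (smult c p) z = of_real c * ev p z" for c p z
    by (induction p) (simp_all add: ev_0 ev_pCons algebra_simps)
  have ev_mult: "ev (p * r) z = ev p z * ev r z" for p r z
    by (induction p) (simp_all add: ev_0 ev_pCons ev_add ev_smult algebra_simps)
  have ev_real: "ev p (of_real l) = of_real (poly p l)" for p l
    by (induction p) (simp_all add: ev_0 ev_pCons)
  have "degree (map_poly complex_of_real q) = degree q"
    by (rule degree_map_poly) auto
  with assms obtain z where z: "ev q z = 0"
    unfolding ev_def by (metis constant_degree fundamental_theorem_of_algebra neq0_conv)
  show ?thesis
  proof (cases "Im z = 0")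
    case True
    then have "z = of_real (Re z)" by (simp add: complex_eq_iff)
    then have "poly q (Re z) = 0" using z ev_real[of q "Re z"] by simp
    then show ?thesis by blast
  next
    case False
    define a b where "a = Re z" and "b = Im z"
    (* The minimal polynomial of z over the reals; the remainder of q modulo d is linear and
       vanishes at the nonreal z, hence is zero. *)
    define d where "d = [:- a, 1:]\<^sup>2 + [:b\<^sup>2:]"
    have d: "d = [:a\<^sup>2 + b\<^sup>2, - 2 * a, 1:]" unfolding d_def by (simp add: power2_eq_square)
    have evd: "ev d z = 0"
      unfolding d by (simp add: ev_pCons ev_0 a_def b_def complex_eq_iff power2_eq_square algebra_simps)
    define r where "r = q mod d"
    have qd: "q = d * (q div d) + r" unfolding r_def by simp
    have "degree r < degree d \<or> r = 0"
      unfolding r_def using degree_mod_less[of d q] d by auto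
    then have "degree r \<le> 1" unfolding d by auto
    then obtain e f where r: "r = [:e, f:]"
      by (cases r, cases "degree r") (auto split: if_splits elim!: degree_eq_zeroE)
    have "ev r z = 0" using z qd ev_add ev_mult evd by (metis add_0 mult_zero_left)
    then have "f = 0" "e = 0" using False by (auto simp: r ev_pCons ev_0 complex_eq_iff)
    then show ?thesis using qd r False unfolding d_def b_def by auto
  qed
qed

text \<open>
  Lower bounds multiply along a factorization, so the claim reduces to the factors that occur over
  the reals: constants, linear factors whose root is outside the spectrum, and irreducible quadratics.
\<close>
lemma jpoly_lower_bound:
  fixes A :: "'a::unital_jb_algebra"
  assumes "q \<noteq> 0" "\<And>l. l \<in> jspectrum A \<Longrightarrow> poly q l \<noteq> 0"
  shows "\<exists>k>0. \<forall>v. k * norm (jpoly v A) \<le> norm (jpoly (q * v) A)"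
  using assms
proof (induction "degree q" arbitrary: q rule: less_induct)
  case less
  have factor: ?case if q: "q = d * r" and deg: "degree d > 0" and k: "k > 0"
    "\<forall>v. k * norm (jpoly v A) \<le> norm (jpoly (d * v) A)" for d r k
  proof -
    have "degree r < degree q" using q deg less.prems(1) by (simp add: degree_mult_eq)
    moreover have "r \<noteq> 0" using q less.prems(1) by auto
    moreover have "poly r l \<noteq> 0" if "l \<in> jspectrum A" for l
      using less.prems(2)[OF that] q by auto
    ultimately obtain k' where k': "k' > 0" "\<forall>v. k' * norm (jpoly v A) \<le> norm (jpoly (r * v) A)"
      using less.hyps by blast
    have "k * k' * norm (jpoly v A) \<le> norm (jpoly (q * v) A)" for v
    proof -
      have "k * (k' * norm (jpoly v A)) \<le> k * norm (jpoly (r * v) A)"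
        using k' k(1) by simp
      also have "\<dots> \<le> norm (jpoly (d * (r * v)) A)" using k(2) by blast
      finally show ?thesis by (simp add: q mult.assoc)
    qed
    then show ?thesis using k k' by (intro exI[of _ "k * k'"]) auto
  qed
  show ?case
  proof (cases "degree q = 0")
    case True
    then obtain c where c: "q = [:c:]" by (metis degree_eq_zeroE)
    then show ?thesis using less.prems(1) by (intro exI[of _ "\<bar>c\<bar>"]) (simp add: jpoly_smult)
  next
    case False
    then consider l where "poly q l = 0"
      | a b v where "b \<noteq> 0" "q = ([:- a, 1:]\<^sup>2 + [:b\<^sup>2:]) * v"
      using real_poly_root_or_quadratic_factor[of q] by auto
    then show ?thesis
    proof cases
      case 1
      then obtain r where r: "q = [:- l, 1:] * r" by (metis poly_eq_0_iff_dvd dvdE)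
      have "l \<notin> jspectrum A" using 1 less.prems(2) by blast
      then obtain k where "k > 0" "\<forall>v. k * norm (jpoly v A) \<le> norm (jpoly ([:- l, 1:] * v) A)"
        using jpoly_linear_lower_bound by blast
      then show ?thesis by (rule factor[OF r, rotated]) simp
    next
      case 2
      have "degree ([:- a, 1:]\<^sup>2 + [:b\<^sup>2:]) > 0" by (simp add: power2_eq_square)
      moreover have "b\<^sup>2 > 0" using 2 by simp
      ultimately show ?thesis by (rule factor[OF 2(2)]) (use jpoly_quadratic_lower_bound in blast)
    qed
  qed
qed

text \<open>
  This is monotonicity of the norm on sums of squares for \<open>(1 + x\<^sup>2)\<^sup>2 = (2x)\<^sup>2 + (1 - x\<^sup>2)\<^sup>2\<close>. It makes
  each factor in the product below double the norm.
\<close>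
lemma norm_jpoly_one_plus_square:
  fixes A :: "'a::unital_jb_algebra"
  shows "2 * norm (jpoly (x * w) A) \<le> norm (jpoly ((1 + x\<^sup>2) * w) A)"
proof -
  define P where "P = jpoly (2 * x * w) A"
  define Q where "Q = jpoly ((1 - x\<^sup>2) * w) A"
  have "((1 + x\<^sup>2) * w) * ((1 + x\<^sup>2) * w) = (2 * x * w) * (2 * x * w) + ((1 - x\<^sup>2) * w) * ((1 - x\<^sup>2) * w)"
    by algebra
  then have "(norm (jpoly ((1 + x\<^sup>2) * w) A))\<^sup>2 = norm (P \<odot> P + Q \<odot> Q)"
    unfolding P_def Q_def by (metis norm_jsquare jpoly_mult jpoly_add)
  then have "(norm P)\<^sup>2 \<le> (norm (jpoly ((1 + x\<^sup>2) * w) A))\<^sup>2"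
    using norm_jsquare_le_add[of P Q] by (simp add: norm_jsquare)
  then have "norm P \<le> norm (jpoly ((1 + x\<^sup>2) * w) A)" by (rule power2_le_imp_le) simp
  moreover have "2 * x * w = smult 2 (x * w)" by (simp add: numeral_poly)
  ultimately show ?thesis unfolding P_def by (simp add: jpoly_smult)
qed

lemma norm_jpoly_prod_one_plus:
  fixes A :: "'a::unital_jb_algebra"
  shows "2 ^ k * norm (jpoly (x ^ (2 ^ k - 1) * w) A)
    \<le> norm (jpoly ((\<Prod>i<k. 1 + x ^ (2 * 2 ^ i)) * w) A)"
proof (induction k arbitrary: w)
  case 0 then show ?case by simp
next
  case (Suc k)
  have "2 ^ Suc k * norm (jpoly (x ^ (2 ^ Suc k - 1) * w) A)
      = 2 ^ k * (2 * norm (jpoly (x ^ (2 ^ k) * (x ^ (2 ^ k - 1) * w)) A))"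
  proof -
    have "(1::nat) \<le> 2 ^ k" by simp
    then have "(2::nat) ^ Suc k - 1 = 2 ^ k + (2 ^ k - 1)" unfolding power_Suc by linarith
    then show ?thesis by (simp only: power_add power_Suc mult.assoc mult.left_commute)
  qed
  also have "\<dots> \<le> 2 ^ k * norm (jpoly ((1 + (x ^ (2 ^ k))\<^sup>2) * (x ^ (2 ^ k - 1) * w)) A)"
    by (intro mult_left_mono norm_jpoly_one_plus_square) simp
  also have "\<dots> = 2 ^ k * norm (jpoly (x ^ (2 ^ k - 1) * ((1 + x ^ (2 * 2 ^ k)) * w)) A)"
  proof -
    have "(x ^ (2 ^ k))\<^sup>2 = x ^ (2 * 2 ^ k)" by (simp add: mult.commute flip: power_mult)
    then show ?thesis by (simp only: mult.left_commute)
  qed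
  also have "\<dots> \<le> norm (jpoly ((\<Prod>i<k. 1 + x ^ (2 * 2 ^ i)) * ((1 + x ^ (2 * 2 ^ k)) * w)) A)"
    by (rule Suc.IH)
  finally show ?case by (simp add: mult.assoc)
qed

lemma norm_jpoly_power_le: "norm (jpoly (p ^ k) A) \<le> norm (jpoly p A) ^ k"
  if "norm (1::'a) = 1" for A :: "'a::unital_jb_algebra"
proof (induction k)
  case 0 then show ?case using that by (simp add: jpoly_1)
next
  case (Suc k)
  have "norm (jpoly (p ^ Suc k) A) \<le> norm (jpoly p A) * norm (jpoly (p ^ k) A)"
    by (simp add: jpoly_mult norm_jprod_le)
  also have "\<dots> \<le> norm (jpoly p A) * norm (jpoly p A) ^ k"
    by (intro mult_left_mono Suc) simp
  finally show ?case by simp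
qed

lemma norm_jpoly_power_two_power: "norm (jpoly (p ^ (2 ^ k)) A) = norm (jpoly p A) ^ (2 ^ k)"
proof (induction k)
  case (Suc k)
  have "p ^ (2 ^ Suc k) = p ^ (2 ^ k) * p ^ (2 ^ k)" by (simp add: mult_2 power_add)
  then have "norm (jpoly (p ^ (2 ^ Suc k)) A) = (norm (jpoly (p ^ (2 ^ k)) A))\<^sup>2"
    by (simp only: jpoly_mult norm_jsquare)
  then show ?case using Suc by (simp add: mult_2 power_add power2_eq_square)
qed simp

lemma norm_one_jb: "norm (1::'a::unital_jb_algebra) = 1" if "(1::'a) \<noteq> 0"
proof -
  have "norm (1::'a) = (norm (1::'a))\<^sup>2" using norm_jsquare[of "1::'a"] by (simp add: jprod_linear)
  then show ?thesis using that by (simp add: power2_eq_square)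
qed

text \<open>
  The product of the factors \<open>1 + x\<^sup>2\<^sup>j\<close>, where \<open>j\<close> runs through the first \<open>m\<close> powers of \<open>2\<close>, has norm at
  least \<open>2\<^sup>m\<close>, but its product with \<open>1 - x\<^sup>2\<close> telescopes to an element of norm at most \<open>2\<close>.
\<close>
lemma unit_norm_not_bounded_below:
  fixes A :: "'a::unital_jb_algebra"
  assumes one: "(1::'a) \<noteq> 0" and x: "norm (jpoly x A) = 1" and k: "k > 0"
    and lb: "\<And>v. k * norm (jpoly v A) \<le> norm (jpoly ((1 - x\<^sup>2) * v) A)"
  shows False
proof -
  note n1 = norm_one_jb[OF one]
  obtain m where m: "2 / k < 2 ^ m" using real_arch_pow[of 2 "2 / k"] by auto
  define v where "v = (\<Prod>i<m. 1 + x ^ (2 * 2 ^ i))"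
  have tel: "(1 - x\<^sup>2) * (\<Prod>i<n. 1 + x ^ (2 * 2 ^ i)) = 1 - x ^ (2 * 2 ^ n)" for n
  proof (induction n)
    case (Suc n)
    have "(1 - x\<^sup>2) * (\<Prod>i<Suc n. 1 + x ^ (2 * 2 ^ i)) = (1 - x ^ (2 * 2 ^ n)) * (1 + x ^ (2 * 2 ^ n))"
      by (simp add: Suc[symmetric] mult.assoc)
    also have "\<dots> = 1 - x ^ (2 * 2 ^ n) * x ^ (2 * 2 ^ n)" by (simp add: algebra_simps)
    finally show ?case by (simp flip: power_add)
  qed simp
  (* The exponent of x in the lower bound for v is 2^m - 1, not a power of 2, where the norm is only
     submultiplicative; multiplying by one more x reaches a power of 2. *)
  have "1 = norm (jpoly (x ^ (2 ^ m)) A)" by (simp add: norm_jpoly_power_two_power x)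
  also have "x ^ (2 ^ m) = x ^ (2 ^ m - 1) * x" by (metis power_minus_mult zero_less_numeral zero_less_power)
  also have "norm (jpoly (x ^ (2 ^ m - 1) * x) A) \<le> norm (jpoly (x ^ (2 ^ m - 1)) A) * norm (jpoly x A)"
    by (simp add: jpoly_mult norm_jprod_le)
  finally have "1 \<le> norm (jpoly (x ^ (2 ^ m - 1)) A)" by (simp add: x)
  then have "2 ^ m * 1 \<le> 2 ^ m * norm (jpoly (x ^ (2 ^ m - 1) * 1) A)"
    by (intro mult_left_mono) auto
  also have "\<dots> \<le> norm (jpoly v A)"
    using norm_jpoly_prod_one_plus[of m x 1 A] unfolding v_def by simp
  finally have "2 ^ m \<le> norm (jpoly v A)" by simp
  then have "k * 2 ^ m \<le> k * norm (jpoly v A)" using k by simp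
  also have "\<dots> \<le> norm (jpoly (1 - x ^ (2 * 2 ^ m)) A)" using lb[of v] tel[of m] by (simp add: v_def)
  also have "\<dots> \<le> norm (1::'a) + norm (jpoly (x ^ (2 * 2 ^ m)) A)"
    unfolding jpoly_diff jpoly_1 by (rule norm_triangle_ineq4)
  also have "\<dots> \<le> 2" using norm_jpoly_power_le[OF n1, of x "2 * 2 ^ m" A] by (simp add: n1 x)
  finally show False using m k by (simp add: field_simps)
qed

text \<open>
  With \<open>r\<close> the norm of \<open>p(A)\<close>, the polynomial \<open>r\<^sup>2 - p\<^sup>2\<close> must vanish somewhere on the spectrum:
  otherwise multiplication by it is bounded below. This is absurd on the constant polynomial \<open>1\<close> if
  \<open>r = 0\<close>, and contradicts the preceding lemma after rescaling \<open>p\<close> to norm one if \<open>r > 0\<close>.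
  The degree condition guarantees \<open>r\<^sup>2 - p\<^sup>2 \<noteq> 0\<close>.
\<close>
lemma norm_jpoly_attained:
  fixes A :: "'a::unital_jb_algebra"
  assumes one: "(1::'a) \<noteq> 0" and deg: "degree p > 0"
  shows "\<exists>l\<in>jspectrum A. \<bar>poly p l\<bar> = norm (jpoly p A)"
proof (rule ccontr)
  assume neg: "\<not> ?thesis"
  define r where "r = norm (jpoly p A)"
  define q where "q = [:r\<^sup>2:] - p\<^sup>2"
  have "poly q l \<noteq> 0" if "l \<in> jspectrum A" for l
  proof
    assume "poly q l = 0"
    then have "\<bar>poly p l\<bar> = \<bar>r\<bar>" unfolding q_def by (auto simp: power2_eq_iff abs_eq_iff)
    then show False using neg that unfolding r_def by auto
  qed
  moreover have "q \<noteq> 0"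
  proof
    assume "q = 0"
    then have "degree (p\<^sup>2) = 0" unfolding q_def by (metis degree_pCons_0 eq_iff_diff_eq_0)
    then show False using deg by (cases "p = 0") (auto simp: degree_power_eq)
  qed
  ultimately obtain k where k: "k > 0" "\<And>v. k * norm (jpoly v A) \<le> norm (jpoly (q * v) A)"
    using jpoly_lower_bound[of q A] by blast
  show False
  proof (cases "r = 0")
    case True
    then have "jpoly q A = 0" unfolding q_def r_def
      by (simp add: jpoly_minus power2_eq_square jpoly_mult jprod_linear)
    then show False using k(2)[of 1] k(1) by (simp add: jpoly_1 norm_one_jb[OF one])
  next
    case False
    then have r: "r > 0" unfolding r_def by simp
    define x where "x = smult (1 / r) p"
    have qx: "q = smult (r\<^sup>2) (1 - x\<^sup>2)"
    proof -
      have "x\<^sup>2 = smult (1 / r\<^sup>2) (p\<^sup>2)" unfolding x_def by (simp add: power2_eq_square)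
      then show ?thesis unfolding q_def using False by (simp add: smult_diff_right)
    qed
    show False
    proof (rule unit_norm_not_bounded_below[OF one, of x A "k / r\<^sup>2"])
      show "norm (jpoly x A) = 1" unfolding x_def using r by (simp add: jpoly_smult r_def)
      show "k / r\<^sup>2 > 0" using k r by simp
      show "k / r\<^sup>2 * norm (jpoly v A) \<le> norm (jpoly ((1 - x\<^sup>2) * v) A)" for v
        using k(2)[of v] r unfolding qx by (simp add: jpoly_smult field_simps)
    qed
  qed
qed

text \<open>
  A constant \<open>p\<close> needs a point of the spectrum, which exists by the preceding lemma for the identity
  polynomial. In the trivial algebra, where \<open>1 = 0\<close> and the spectrum is empty, the assumption
  \<open>s \<ge> 0\<close> carries the claim.
\<close>
lemma norm_jpoly_le:
  fixes A :: "'a::unital_jb_algebra"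
  assumes "s \<ge> 0" "\<And>l. l \<in> jspectrum A \<Longrightarrow> \<bar>poly p l\<bar> \<le> s"
  shows "norm (jpoly p A) \<le> s"
proof (cases "(1::'a) = 0")
  case True
  have "jpoly p A = 1 \<odot> jpoly p A" by (simp only: jprod_one_left)
  then show ?thesis using True assms(1) by (simp add: jprod_zero_left)
next
  case False
  show ?thesis
  proof (cases "degree p = 0")
    case True
    then obtain c where p: "p = [:c:]" by (metis degree_eq_zeroE)
    obtain l where "l \<in> jspectrum A" using norm_jpoly_attained[OF False, of "[:0, 1:]" A] by auto
    then show ?thesis using assms(2) norm_one_jb[OF False] p by (auto simp: jpoly_pCons jpoly_0 jprod_linear)
  next
    case F: False
    then show ?thesis using norm_jpoly_attained[OF False, of p A] assms(2) by (metis neq0_conv)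
  qed
qed

section \<open>The spectrum is bounded\<close>

lemma jinvertible_scaleR:
  assumes "jinvertible A" "c \<noteq> 0"
  shows "jinvertible (c *\<^sub>R A)"
proof -
  obtain B where B: "A \<odot> B = 1" "(A \<odot> A) \<odot> B = A" using assms(1) unfolding jinvertible_def by blast
  show ?thesis unfolding jinvertible_def
    by (rule exI[of _ "(1 / c) *\<^sub>R B"]) (use assms(2) B in \<open>simp add: jprod_linear\<close>)
qed

text \<open>
  The Neumann series of powers of \<open>u\<close> satisfies both equations of a Jordan inverse.
\<close>
lemma jinvertible_one_minus:
  fixes u :: "'a::unital_jb_algebra"
  assumes "norm u < 1"
  shows "jinvertible (1 - u)"
proof -
  define S where "S = (\<Sum>n. jpow u n)"
  have le: "norm (jpow u n) \<le> norm (1::'a) * norm u ^ n" for n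
  proof (induction n)
    case (Suc n)
    have "norm (jpow u (Suc n)) \<le> norm u * norm (jpow u n)" by (simp add: norm_jprod_le)
    also have "\<dots> \<le> norm u * (norm (1::'a) * norm u ^ n)" by (intro mult_left_mono Suc) simp
    finally show ?case by (simp add: algebra_simps)
  qed simp
  have sm: "summable (jpow u)"
    by (rule summable_comparison_test'[OF _ le])
       (use assms in \<open>simp add: summable_mult summable_geometric\<close>)
  have "(\<lambda>n. u \<odot> jpow u n) sums (u \<odot> S)"
    unfolding S_def
    by (rule bounded_linear.sums[OF bounded_bilinear.bounded_linear_right[OF bounded_bilinear_jprod]])
       (rule summable_sums[OF sm])
  moreover have "(\<lambda>n. jpow u (Suc n)) sums (S - 1)"
    using summable_sums[OF sm] unfolding S_def by (subst sums_Suc_iff) simp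
  ultimately have uS: "u \<odot> S = S - 1" by (simp add: sums_unique2)
  have "(\<lambda>n. (u \<odot> u) \<odot> jpow u n) sums ((u \<odot> u) \<odot> S)"
    unfolding S_def
    by (rule bounded_linear.sums[OF bounded_bilinear.bounded_linear_right[OF bounded_bilinear_jprod]])
       (rule summable_sums[OF sm])
  moreover have "(u \<odot> u) \<odot> jpow u n = jpow u (Suc (Suc n))" for n
    by (induction n) (simp_all add: jprod_linear jprod_square_commute)
  moreover have "(\<lambda>n. jpow u (Suc (Suc n))) sums (S - 1 - u)"
    using \<open>(\<lambda>n. jpow u (Suc n)) sums (S - 1)\<close> by (subst sums_Suc_iff) (simp add: jprod_linear)
  ultimately have uuS: "(u \<odot> u) \<odot> S = S - 1 - u" by (metis (no_types, lifting) sums_cong sums_unique2)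
  show ?thesis unfolding jinvertible_def
    by (rule exI[of _ S]) (simp add: jprod_linear uS uuS)
qed

text \<open>
  For \<open>\<bar>l\<bar> > norm A\<close> the Neumann series inverts \<open>1 - A / l\<close>. The bound places the spectrum in a compact
  interval, on which continuous functions are uniform limits of polynomials.
\<close>
lemma jspectrum_bound:
  assumes "l \<in> jspectrum A"
  shows "\<bar>l\<bar> \<le> norm A"
proof (rule ccontr)
  assume neg: "\<not> ?thesis"
  then have l: "l \<noteq> 0" by auto
  have "norm ((1 / l) *\<^sub>R A) < 1" using neg l by simp
  then have "jinvertible (1 - (1 / l) *\<^sub>R A)" by (rule jinvertible_one_minus)
  then have "jinvertible (- l *\<^sub>R (1 - (1 / l) *\<^sub>R A))" using l by (intro jinvertible_scaleR) auto
  then show False using assms l by (simp add: jspectrum_def scaleR_diff_right)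
qed

lemma jspectrum_subset: "norm A \<le> R \<Longrightarrow> jspectrum A \<subseteq> {-R..R}"
  using jspectrum_bound[of _ A] by force

lemma jspectrum_affine:
  assumes "t \<noteq> 0" "x \<in> jspectrum (1 + t *\<^sub>R A)"
  shows "(x - 1) / t \<in> jspectrum A"
proof (rule ccontr)
  assume "\<not> ?thesis"
  then have "jinvertible (t *\<^sub>R (A - ((x - 1) / t) *\<^sub>R 1))"
    using assms(1) by (intro jinvertible_scaleR) (simp_all add: jspectrum_def)
  moreover have "t *\<^sub>R (A - ((x - 1) / t) *\<^sub>R 1) = 1 + t *\<^sub>R A - x *\<^sub>R 1"
    using assms(1) by (simp add: scaleR_diff_right scaleR_diff_left)
  ultimately show False using assms(2) by (simp add: jspectrum_def)
qed

section \<open>Continuous functional calculus\<close>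

text \<open>
  By the norm estimate, polynomials that are uniformly close on the spectrum have values at \<open>A\<close> that
  are equally close. So one approximating sequence produces a limit, and every other sequence
  produces the same one; this is what makes \<open>jfun f A\<close> well defined.
\<close>
lemma jfun_limit:
  fixes A :: "'a::unital_jb_algebra"
  assumes "jspectrum A \<subseteq> K" "uniform_limit K (\<lambda>n. poly (p n)) f sequentially"
  shows "(\<lambda>n. jpoly (p n) A) \<longlonglongrightarrow> jfun f A"
proof -
  have diff: "\<exists>N. \<forall>m\<ge>N. \<forall>n\<ge>N. norm (jpoly (q m) A - jpoly (r n) A) < e"
    if qr: "uniform_limit (jspectrum A) (\<lambda>n. poly (q n)) f sequentially"
       "uniform_limit (jspectrum A) (\<lambda>n. poly (r n)) f sequentially" "e > 0" for q r e
  proof -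
    have "e / 4 > 0" using qr by simp
    then obtain M N where M: "\<And>n l. n \<ge> M \<Longrightarrow> l \<in> jspectrum A \<Longrightarrow> dist (poly (q n) l) (f l) < e / 4"
      and N: "\<And>n l. n \<ge> N \<Longrightarrow> l \<in> jspectrum A \<Longrightarrow> dist (poly (r n) l) (f l) < e / 4"
      using qr(1,2) unfolding uniform_limit_sequentially_iff by metis
    have "norm (jpoly (q m) A - jpoly (r n) A) < e" if mn: "m \<ge> max M N" "n \<ge> max M N" for m n
    proof -
      have "norm (jpoly (q m - r n) A) \<le> e / 2"
      proof (rule norm_jpoly_le)
        fix l assume "l \<in> jspectrum A"
        then show "\<bar>poly (q m - r n) l\<bar> \<le> e / 2"
          using M[of m l] N[of n l] mn unfolding dist_real_def poly_diff by (simp add: abs_if split: if_splits)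
      qed (use \<open>e > 0\<close> in simp)
      then show ?thesis using \<open>e > 0\<close> by (simp add: jpoly_diff)
    qed
    then show ?thesis by blast
  qed
  have p: "uniform_limit (jspectrum A) (\<lambda>n. poly (p n)) f sequentially"
    using assms uniform_limit_on_subset by blast
  have "Cauchy (\<lambda>n. jpoly (p n) A)"
    using diff[OF p p] by (simp add: Cauchy_iff)
  then obtain B where B: "(\<lambda>n. jpoly (p n) A) \<longlonglongrightarrow> B"
    by (auto simp: Cauchy_convergent_iff convergent_def)
  have all: "(\<lambda>n. jpoly (q n) A) \<longlonglongrightarrow> B"
    if "uniform_limit (jspectrum A) (\<lambda>n. poly (q n)) f sequentially" for q
  proof -
    have "(\<lambda>n. jpoly (q n) A - jpoly (p n) A) \<longlonglongrightarrow> 0"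
      unfolding LIMSEQ_iff using diff[OF that p] by simp blast
    from tendsto_add[OF this B] show ?thesis by simp
  qed
  have "jfun f A = B"
    unfolding jfun_def
    by (rule the_equality) (use all p B LIMSEQ_unique in blast)+
  then show ?thesis using B by simp
qed

lemma uniform_limit_poly_exists:
  fixes f :: "real \<Rightarrow> real"
  assumes "continuous_on {a..b} f"
  obtains p where "uniform_limit {a..b} (\<lambda>n. poly (p n)) f sequentially"
proof -
  have "\<exists>p. \<forall>x\<in>{a..b}. \<bar>f x - poly p x\<bar> < 1 / Suc n" for n
  proof -
    obtain g where g: "real_polynomial_function g" "\<And>x. x \<in> {a..b} \<Longrightarrow> \<bar>f x - g x\<bar> < 1 / Suc n"
      using Stone_Weierstrass_real_polynomial_function[of "{a..b}" f "1 / Suc n"] assms by auto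
    then obtain c m where "g = (\<lambda>x. \<Sum>i\<le>m. c i * x ^ i)"
      unfolding real_polynomial_function_iff_sum by blast
    then have "g = poly (\<Sum>i\<le>m. monom (c i) i)" by (simp add: poly_sum poly_monom fun_eq_iff)
    then show ?thesis using g by blast
  qed
  then obtain p where p: "\<And>n x. x \<in> {a..b} \<Longrightarrow> \<bar>f x - poly (p n) x\<bar> < 1 / Suc n" by metis
  have "uniform_limit {a..b} (\<lambda>n. poly (p n)) f sequentially"
    unfolding uniform_limit_iff
  proof (intro allI impI)
    fix e :: real assume "e > 0"
    then have "\<forall>\<^sub>F n in sequentially. 1 / Suc n < e"
      using LIMSEQ_inverse_real_of_nat order_tendstoD(2) by (fastforce simp: inverse_eq_divide)
    then show "\<forall>\<^sub>F n in sequentially. \<forall>x\<in>{a..b}. dist (poly (p n) x) (f x) < e"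
    proof eventually_elim
      case (elim n)
      then show ?case using p[of _ n] by (fastforce simp: dist_real_def abs_minus_commute)
    qed
  qed
  then show ?thesis by (rule that)
qed

lemma jfun_poly: "jfun (poly p) A = jpoly p A"
  using jfun_limit[of A UNIV "\<lambda>_. p" "poly p"] by (simp add: LIMSEQ_const_iff uniform_limit_const)

lemma norm_jfun_diff_le:
  fixes A :: "'a::unital_jb_algebra"
  assumes K: "jspectrum A \<subseteq> {a..b}" and "continuous_on {a..b} f" "continuous_on {a..b} g"
    and e: "e \<ge> 0" "\<And>x. x \<in> jspectrum A \<Longrightarrow> \<bar>f x - g x\<bar> \<le> e"
  shows "norm (jfun f A - jfun g A) \<le> e"
proof -
  obtain p q where p: "uniform_limit {a..b} (\<lambda>n. poly (p n)) f sequentially"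
    and q: "uniform_limit {a..b} (\<lambda>n. poly (q n)) g sequentially"
    using assms(2,3) uniform_limit_poly_exists by metis
  have lim: "(\<lambda>n. norm (jpoly (p n) A - jpoly (q n) A)) \<longlonglongrightarrow> norm (jfun f A - jfun g A)"
    by (intro tendsto_intros jfun_limit[OF K p] jfun_limit[OF K q])
  show ?thesis
  proof (rule field_le_epsilon)
    fix d :: real assume d: "d > 0"
    then have "d / 2 > 0" by simp
    have "\<forall>\<^sub>F n in sequentially. norm (jpoly (p n) A - jpoly (q n) A) \<le> e + d"
      using uniform_limitD[OF p \<open>d / 2 > 0\<close>] uniform_limitD[OF q \<open>d / 2 > 0\<close>]
    proof eventually_elim
      case (elim n)
      have "norm (jpoly (p n - q n) A) \<le> e + d"
      proof (rule norm_jpoly_le)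
        fix l assume l: "l \<in> jspectrum A"
        then have "\<bar>poly (p n) l - f l\<bar> < d / 2" "\<bar>poly (q n) l - g l\<bar> < d / 2"
          using K elim unfolding dist_real_def by blast+
        then show "\<bar>poly (p n - q n) l\<bar> \<le> e + d"
          using e(2)[OF l] unfolding poly_diff by linarith
      qed (use e d in simp)
      then show ?case by (simp add: jpoly_diff)
    qed
    then show "norm (jfun f A - jfun g A) \<le> e + d"
      using lim by (intro tendsto_upperbound) auto
  qed
qed

lemma continuous_on_jpoly: "continuous_on S (jpoly p)"
proof (induction p)
  case 0 then show ?case by (simp add: jpoly_0)
next
  case (pCons c p)
  then show ?case unfolding jpoly_pCons
    by (intro continuous_intros bounded_bilinear.continuous_on[OF bounded_bilinear_jprod])
qed

text \<open>
  On a norm ball all spectra lie in one interval, so polynomials approximating \<open>f\<close> there approximate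
  \<open>jfun f\<close> uniformly on the ball.
\<close>
lemma continuous_on_jfun:
  assumes f: "continuous_on {-R..R} f"
  shows "continuous_on {A::'a::unital_jb_algebra. norm A \<le> R} (jfun f)"
proof -
  obtain p where p: "uniform_limit {-R..R} (\<lambda>n. poly (p n)) f sequentially"
    using f uniform_limit_poly_exists by metis
  have "uniform_limit {A::'a. norm A \<le> R} (\<lambda>n. jpoly (p n)) (jfun f) sequentially"
    unfolding uniform_limit_iff
  proof (intro allI impI)
    fix e :: real assume e: "e > 0"
    then have "e / 2 > 0" by simp
    from uniform_limitD[OF p this]
    show "\<forall>\<^sub>F n in sequentially. \<forall>A\<in>{A::'a. norm A \<le> R}. dist (jpoly (p n) A) (jfun f A) < e"
    proof eventually_elim
      case (elim n)
      show ?case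
      proof
        fix A :: 'a assume "A \<in> {A. norm A \<le> R}"
        then have K: "jspectrum A \<subseteq> {-R..R}" by (intro jspectrum_subset) simp
        have "norm (jfun (poly (p n)) A - jfun f A) \<le> e / 2"
        proof (rule norm_jfun_diff_le[OF K _ f])
          fix l assume "l \<in> jspectrum A"
          then show "\<bar>poly (p n) l - f l\<bar> \<le> e / 2"
            using K elim unfolding dist_real_def by (meson less_imp_le subsetD)
        qed (use e in \<open>auto intro!: continuous_intros\<close>)
        then show "dist (jpoly (p n) A) (jfun f A) < e" using e by (simp add: jfun_poly dist_norm)
      qed
    qed
  qed
  then show ?thesis by (rule uniform_limit_theorem[OF always_eventually[OF allI[OF continuous_on_jpoly]] _ sequentially_bot])
qed

text \<open>
  The spectrum of \<open>1 + tA\<close> and the values of polynomials at it both transform by \<open>x \<mapsto> 1 + tx\<close>.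
\<close>
lemma jfun_affine:
  fixes A :: "'a::unital_jb_algebra"
  assumes t: "t \<noteq> 0" and K: "jspectrum A \<subseteq> {a..b}"
    and f: "continuous_on {c..d} f" and img: "\<And>x. x \<in> {a..b} \<Longrightarrow> 1 + t * x \<in> {c..d}"
  shows "jfun f (1 + t *\<^sub>R A) = jfun (\<lambda>x. f (1 + t * x)) A"
proof -
  obtain p where p: "uniform_limit {c..d} (\<lambda>n. poly (p n)) f sequentially"
    using f uniform_limit_poly_exists by metis
  have "jspectrum (1 + t *\<^sub>R A) \<subseteq> {c..d}"
  proof
    fix x assume "x \<in> jspectrum (1 + t *\<^sub>R A)"
    then have "1 + t * ((x - 1) / t) \<in> {c..d}"
      using img jspectrum_affine[OF t] K by blast
    then show "x \<in> {c..d}" using t by simp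
  qed
  from jfun_limit[OF this p]
  have 1: "(\<lambda>n. jpoly (p n) (1 + t *\<^sub>R A)) \<longlonglongrightarrow> jfun f (1 + t *\<^sub>R A)" .
  have *: "uniform_limit {a..b} (\<lambda>n x. poly (p n) (1 + t * x)) (\<lambda>x. f (1 + t * x)) sequentially"
    by (rule uniform_limit_compose'[OF p]) (use img in auto)
  have "uniform_limit {a..b} (\<lambda>n. poly (pcompose (p n) [:1, t:])) (\<lambda>x. f (1 + t * x)) sequentially"
  proof -
    have "poly (pcompose (p n) [:1, t:]) = (\<lambda>x. poly (p n) (1 + t * x))" for n
      by (simp add: fun_eq_iff poly_pcompose mult.commute)
    then show ?thesis using * by simp
  qed
  from jfun_limit[OF K this]
  have "(\<lambda>n. jpoly (p n) (jpoly [:1, t:] A)) \<longlonglongrightarrow> jfun (\<lambda>x. f (1 + t * x)) A"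
    by (simp add: jpoly_pcompose)
  moreover have "jpoly [:1, t:] A = 1 + t *\<^sub>R A"
    by (simp add: jpoly_pCons jpoly_0 jprod_linear)
  ultimately show ?thesis using 1 LIMSEQ_unique by metis
qed

lemma jpoly_jfun:
  fixes A :: "'a::unital_jb_algebra"
  assumes K: "jspectrum A \<subseteq> {a..b}" and f: "continuous_on {a..b} f"
  shows "jpoly p (jfun f A) = jfun (\<lambda>x. poly p (f x)) A"
proof -
  obtain q where q: "uniform_limit {a..b} (\<lambda>n. poly (q n)) f sequentially"
    using f uniform_limit_poly_exists by metis
  have "isCont (jpoly p) (jfun f A)"
    using continuous_on_jpoly[of "UNIV :: 'a set" p] by (simp add: continuous_on_eq_continuous_at)
  then have 1: "(\<lambda>n. jpoly p (jpoly (q n) A)) \<longlonglongrightarrow> jpoly p (jfun f A)"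
    using jfun_limit[OF K q] by (rule isCont_tendsto_compose)
  obtain c d where cd: "f ` {a..b} \<subseteq> {c..d}"
    using compact_imp_bounded[OF compact_continuous_image[OF f compact_Icc]]
    by (metis bounded_subset_cbox_symmetric cbox_interval)
  have *: "uniform_limit {a..b} (\<lambda>n x. poly p (poly (q n) x)) (\<lambda>x. poly p (f x)) sequentially"
  proof (rule uniform_limit_compose_uniformly_continuous_on[OF q])
    (* The approximating polynomials may leave the range of f, but eventually by less than 1. *)
    show "uniformly_continuous_on {c - 1..d + 1} (poly p)"
      by (intro compact_uniformly_continuous continuous_intros compact_Icc)
    show "\<forall>\<^sub>F n in sequentially. \<forall>x\<in>{a..b}. poly (q n) x \<in> {c - 1..d + 1}"
      using uniform_limitD[OF q zero_less_one]
    proof eventually_elim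
      case (elim n)
      show ?case
      proof
        fix x assume "x \<in> {a..b}"
        then have "f x \<in> {c..d}" "\<bar>poly (q n) x - f x\<bar> < 1"
          using cd elim by (blast, simp add: dist_real_def)
        then show "poly (q n) x \<in> {c - 1..d + 1}" by auto
      qed
    qed
  qed simp
  have "poly (pcompose p (q n)) = (\<lambda>x. poly p (poly (q n) x))" for n
    by (simp add: fun_eq_iff poly_pcompose)
  then have "uniform_limit {a..b} (\<lambda>n. poly (pcompose p (q n))) (\<lambda>x. poly p (f x)) sequentially"
    using * by simp
  from jfun_limit[OF K this] 1 show ?thesis
    by (simp add: jpoly_pcompose LIMSEQ_unique)
qed

text \<open>
  The logarithm recovers the exponent. Polynomials \<open>p\<^sub>n\<close> tending to \<open>ln\<close> uniformly on
  \<open>[exp (-R), exp R]\<close> satisfy \<open>p\<^sub>n(exp Y) \<longlongrightarrow> Y\<close> whenever the spectrum of \<open>Y\<close> lies in \<open>[-R, R]\<close>.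
\<close>
lemma jexp_inj:
  fixes X Z :: "'a::unital_jb_algebra"
  assumes "jexp X = jexp Z"
  shows "X = Z"
proof -
  define R where "R = max (norm X) (norm Z)"
  have R: "R \<ge> 0" unfolding R_def by (simp add: le_max_iff_disj)
  have "continuous_on {exp (-R)..exp R} ln"
    by (intro continuous_intros) (use exp_gt_zero[of "-R"] in auto)
  then obtain p where p: "uniform_limit {exp (-R)..exp R} (\<lambda>n. poly (p n)) ln sequentially"
    by (rule uniform_limit_poly_exists)
  have log: "(\<lambda>n. jpoly (p n) (jexp Y)) \<longlonglongrightarrow> Y" if Y: "norm Y \<le> R" for Y :: 'a
    unfolding tendsto_iff dist_norm
  proof (intro allI impI)
    fix e :: real assume e: "e > 0"
    then have "e / 2 > 0" by simp
    have K: "jspectrum Y \<subseteq> {-R..R}" using Y by (rule jspectrum_subset)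
    from uniform_limitD[OF p \<open>e / 2 > 0\<close>]
    show "\<forall>\<^sub>F n in sequentially. norm (jpoly (p n) (jexp Y) - Y) < e"
    proof eventually_elim
      case (elim n)
      have "norm (jfun (\<lambda>x. poly (p n) (exp x)) Y - jfun (poly [:0, 1:]) Y) \<le> e / 2"
      proof (rule norm_jfun_diff_le[OF K])
        fix x assume "x \<in> jspectrum Y"
        then have "exp x \<in> {exp (-R)..exp R}" using K by auto
        then have "\<bar>poly (p n) (exp x) - ln (exp x)\<bar> < e / 2" using elim unfolding dist_real_def by blast
        then show "\<bar>poly (p n) (exp x) - poly [:0, 1:] x\<bar> \<le> e / 2" by simp
      qed (use e in \<open>auto intro!: continuous_intros\<close>)
      then show ?case using e jpoly_jfun[OF K, of exp "p n"]
        unfolding jfun_poly jpoly_X by (simp add: jexp_def continuous_intros)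
    qed
  qed
  have "norm X \<le> R" "norm Z \<le> R" unfolding R_def by auto
  then show ?thesis using log assms LIMSEQ_unique by metis
qed

section \<open>Roots along curves through the unit\<close>

text \<open>
  The exponents \<open>ln (1 + tx) / t\<close> and \<open>x\<close> differ by \<open>O(t)\<close>, and neither exceeds \<open>2M\<close>, so the mean value
  estimate for \<open>exp\<close> applies. The bound is uniform in \<open>x\<close>, as needed to apply it on a spectrum.
\<close>
lemma abs_powr_inverse_minus_exp_le:
  fixes x t M :: real
  assumes x: "\<bar>x\<bar> \<le> M" and t: "t \<noteq> 0" "\<bar>t\<bar> * M \<le> 1 / 2"
  shows "\<bar>(1 + t * x) powr (1 / t) - exp x\<bar> \<le> 2 * M\<^sup>2 * exp (2 * M) * \<bar>t\<bar>"
proof -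
  have "\<bar>t * x\<bar> \<le> \<bar>t\<bar> * M" unfolding abs_mult using x by (intro mult_left_mono) auto
  then have tx: "\<bar>t * x\<bar> \<le> 1 / 2" using t by linarith
  define y where "y = ln (1 + t * x) / t"
  have M: "0 \<le> M" using x by linarith
  have "\<bar>y - x\<bar> = \<bar>ln (1 + t * x) - t * x\<bar> / \<bar>t\<bar>"
    unfolding y_def using t(1) by (simp add: field_simps flip: abs_divide)
  also have "\<dots> \<le> (2 * (t * x)\<^sup>2) / \<bar>t\<bar>"
    using abs_ln_one_plus_x_minus_x_bound[OF tx] by (intro divide_right_mono) auto
  also have "\<dots> = 2 * \<bar>t\<bar> * x\<^sup>2"
    using t(1) by (cases "t > 0") (auto simp: power2_eq_square field_simps)
  also have "\<dots> \<le> 2 * \<bar>t\<bar> * M\<^sup>2"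
    using x by (intro mult_left_mono) (auto intro: abs_le_square_iff[THEN iffD1])
  finally have yx: "\<bar>y - x\<bar> \<le> 2 * \<bar>t\<bar> * M\<^sup>2" .
  also have "\<dots> = 2 * (\<bar>t\<bar> * M) * M" by (simp add: power2_eq_square)
  also have "\<dots> \<le> 2 * (1 / 2) * M" using t(2) M by (intro mult_right_mono) auto
  finally have "y \<le> 2 * M" "x \<le> 2 * M" using x M by linarith+
  have mv: "exp u - exp v \<le> exp (2 * M) * \<bar>u - v\<bar>" if "u \<le> 2 * M" for u v :: real
  proof -
    have "exp u * (1 + (v - u)) \<le> exp u * exp (v - u)" by (intro mult_left_mono exp_ge_add_one_self) simp
    then have "exp u - exp v \<le> exp u * (u - v)" by (simp add: algebra_simps exp_diff)
    also have "\<dots> \<le> exp u * \<bar>u - v\<bar>" by (intro mult_left_mono) auto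
    also have "\<dots> \<le> exp (2 * M) * \<bar>u - v\<bar>" using that by (intro mult_right_mono) auto
    finally show ?thesis .
  qed
  have "\<bar>exp y - exp x\<bar> \<le> exp (2 * M) * \<bar>y - x\<bar>"
    using mv[OF \<open>y \<le> 2 * M\<close>, of x] mv[OF \<open>x \<le> 2 * M\<close>, of y] by (simp add: abs_minus_commute abs_le_iff)
  also have "\<dots> \<le> exp (2 * M) * (2 * \<bar>t\<bar> * M\<^sup>2)" using yx by (intro mult_left_mono) auto
  finally have "\<bar>exp y - exp x\<bar> \<le> 2 * M\<^sup>2 * exp (2 * M) * \<bar>t\<bar>" by (simp add: mult_ac)
  moreover have "1 + t * x \<noteq> 0" using tx by (auto simp: abs_le_iff)
  then have "exp y = (1 + t * x) powr (1 / t)" unfolding y_def powr_def by simp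
  ultimately show ?thesis by simp
qed

lemma norm_jpowr_minus_jexp_le:
  fixes A :: "'a::unital_jb_algebra"
  assumes A: "norm A \<le> M" and t: "t \<noteq> 0" "\<bar>t\<bar> * M \<le> 1 / 2"
  shows "norm (jpowr (1 + t *\<^sub>R A) (1 / t) - jexp A) \<le> 2 * M\<^sup>2 * exp (2 * M) * \<bar>t\<bar>"
proof -
  have K: "jspectrum A \<subseteq> {-M..M}" using A by (rule jspectrum_subset)
  have img: "1 + t * x \<in> {1 / 2..3 / 2}" if "x \<in> {-M..M}" for x
  proof -
    have "\<bar>t * x\<bar> \<le> \<bar>t\<bar> * M" unfolding abs_mult using that by (intro mult_left_mono) auto
    then show ?thesis using t(2) by (auto simp: abs_le_iff)
  qed
  have c: "continuous_on {1 / 2..3 / 2} (\<lambda>x::real. x powr (1 / t))"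
    by (intro continuous_intros) auto
  have "jpowr (1 + t *\<^sub>R A) (1 / t) = jfun (\<lambda>x. (1 + t * x) powr (1 / t)) A"
    unfolding jpowr_def by (rule jfun_affine[OF t(1) K c img])
  moreover have "norm (jfun (\<lambda>x. (1 + t * x) powr (1 / t)) A - jfun exp A) \<le> 2 * M\<^sup>2 * exp (2 * M) * \<bar>t\<bar>"
  proof (rule norm_jfun_diff_le[OF K])
    show "continuous_on {-M..M} (\<lambda>x. (1 + t * x) powr (1 / t))"
      by (rule continuous_on_compose2[OF c]) (use img in \<open>auto intro!: continuous_intros\<close>)
    show "\<bar>(1 + t * x) powr (1 / t) - exp x\<bar> \<le> 2 * M\<^sup>2 * exp (2 * M) * \<bar>t\<bar>" if "x \<in> jspectrum A" for x
    proof (rule abs_powr_inverse_minus_exp_le)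
      show "\<bar>x\<bar> \<le> M" using K that by (auto simp: abs_le_iff)
    qed (use t in auto)
  qed (auto intro!: continuous_intros)
  ultimately show ?thesis by (simp add: jexp_def)
qed

lemma isCont_jexp: "isCont (jexp :: 'a::unital_jb_algebra \<Rightarrow> 'a) X"
proof -
  have "continuous_on {A::'a. norm A \<le> norm X + 1} (jfun exp)"
    by (intro continuous_on_jfun continuous_intros)
  then have "continuous_on (ball 0 (norm X + 1)) (jfun exp :: 'a \<Rightarrow> 'a)"
    by (rule continuous_on_subset) auto
  then show ?thesis unfolding jexp_def
    by (simp add: continuous_on_eq_continuous_at)
qed

text \<open>
  Write \<open>g t = 1 + t a(t)\<close>, where the difference quotient \<open>a(t)\<close> tends to \<open>X\<close>. The root differs from
  \<open>exp (a(t))\<close> by \<open>O(t)\<close>, and \<open>exp\<close> is continuous.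
\<close>
lemma tendsto_jpowr_curve:
  fixes g :: "real \<Rightarrow> 'a::unital_jb_algebra"
  assumes "(g has_vector_derivative X) (at 0)" "g 0 = 1"
  shows "((\<lambda>t. jpowr (g t) (1 / t)) \<longlongrightarrow> jexp X) (at 0)"
proof -
  define a where "a t = (1 / t) *\<^sub>R (g t - 1)" for t
  have "((\<lambda>t. norm (g t - 1 - t *\<^sub>R X) / \<bar>t\<bar>) \<longlongrightarrow> 0) (at 0)"
    using assms unfolding has_vector_derivative_def has_derivative_iff_norm by simp
  moreover have "\<forall>\<^sub>F t in at 0. norm (g t - 1 - t *\<^sub>R X) / \<bar>t\<bar> = norm (a t - X)"
    unfolding eventually_at_filter
  proof (intro always_eventually allI impI)
    fix t :: real assume t: "t \<noteq> 0"
    then have "a t - X = (1 / t) *\<^sub>R (g t - 1 - t *\<^sub>R X)" unfolding a_def by (simp add: scaleR_diff_right)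
    then show "norm (g t - 1 - t *\<^sub>R X) / \<bar>t\<bar> = norm (a t - X)" by simp
  qed
  ultimately have "((\<lambda>t. norm (a t - X)) \<longlongrightarrow> 0) (at 0)" by (rule Lim_transform_eventually)
  then have a: "(a \<longlongrightarrow> X) (at 0)" by (simp add: tendsto_norm_zero_iff LIM_zero_iff)
  define M where "M = norm X + 1"
  have M: "M > 0" unfolding M_def by (simp add: add_nonneg_pos)
  have "\<forall>\<^sub>F t in at 0. norm (a t) < M"
    using tendsto_norm[OF a] by (rule order_tendstoD) (simp add: M_def)
  moreover have "\<forall>\<^sub>F t in at 0. t \<noteq> (0::real)" by (simp add: eventually_at_filter)
  moreover have "\<forall>\<^sub>F t::real in at 0. \<bar>t\<bar> * M < 1 / 2"
  proof (rule order_tendstoD)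
    show "((\<lambda>t::real. \<bar>t\<bar> * M) \<longlongrightarrow> \<bar>0\<bar> * M) (at 0)" by (intro tendsto_intros)
  qed simp
  ultimately have ev: "\<forall>\<^sub>F t in at 0. norm (jpowr (g t) (1 / t) - jexp (a t)) \<le> 2 * M\<^sup>2 * exp (2 * M) * \<bar>t\<bar>"
  proof eventually_elim
    case (elim t)
    have "1 + t *\<^sub>R a t = g t" using elim unfolding a_def by simp
    then show ?case using norm_jpowr_minus_jexp_le[of "a t" M t] elim by simp
  qed
  have "((\<lambda>t::real. 2 * M\<^sup>2 * exp (2 * M) * \<bar>t\<bar>) \<longlongrightarrow> 2 * M\<^sup>2 * exp (2 * M) * \<bar>0\<bar>) (at 0)"
    by (intro tendsto_intros)
  then have "((\<lambda>t::real. 2 * M\<^sup>2 * exp (2 * M) * \<bar>t\<bar>) \<longlongrightarrow> 0) (at 0)" by simp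
  from Lim_null_comparison[OF ev this]
  have "((\<lambda>t. jpowr (g t) (1 / t) - jexp (a t)) \<longlongrightarrow> 0) (at 0)" .
  moreover have "((\<lambda>t. jexp (a t)) \<longlongrightarrow> jexp X) (at 0)"
    using isCont_jexp a by (rule isCont_tendsto_compose)
  ultimately show ?thesis using tendsto_add by fastforce
qed

section \<open>Lie-Trotter means along curves\<close>

lemma cone_curve_has_vector_derivative:
  assumes "cone_curve \<epsilon> g" "\<epsilon> > 0"
  shows "(g has_vector_derivative vector_derivative g (at 0)) (at 0)"
proof -
  have "g differentiable (at 0 within {-\<epsilon><..<\<epsilon>})"
    using assms by (auto simp: cone_curve_def differentiable_on_def)
  then have "g differentiable (at 0)"
    using assms(2) by (metis at_within_open greaterThanLessThan_iff neg_less_0_iff_less open_greaterThanLessThan)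
  then show ?thesis by (simp add: vector_derivative_works)
qed

text \<open>
  The roots of the composed curve converge to the exponential of its derivative, because it is a
  curve through the unit, and to the limit prescribed by the Lie-Trotter property. Injectivity of
  \<open>exp\<close> identifies the derivative.
\<close>
lemma lie_trotter_2mean_curve:
  fixes g1 g2 :: "real \<Rightarrow> 'a::unital_jb_algebra"
  assumes S: "lie_trotter_2mean S2" and l: "l \<in> {0<..<1}" and e: "\<epsilon> > 0"
    and g: "cone_curve \<epsilon> g1" "cone_curve \<epsilon> g2"
  shows "cone_curve \<epsilon> (\<lambda>t. S2 (1 - l) l (g1 t) (g2 t)) \<and>
    vector_derivative (\<lambda>t. S2 (1 - l) l (g1 t) (g2 t)) (at 0)
      = (1 - l) *\<^sub>R vector_derivative g1 (at 0) + l *\<^sub>R vector_derivative g2 (at 0)"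
proof -
  define h where "h t = S2 (1 - l) l (g1 t) (g2 t)" for t
  let ?I = "{-\<epsilon><..<\<epsilon>}"
  have cone: "g1 t \<in> pos_cone" "g2 t \<in> pos_cone" if "t \<in> ?I" for t
    using g that by (auto simp: cone_curve_def)
  have one: "g1 0 = 1" "g2 0 = 1" using g by (auto simp: cone_curve_def)
  have mean: "weighted_2mean S2"
    and diff: "(\<lambda>(A, B). S2 (1 - l) l A B) differentiable_on (pos_cone \<times> pos_cone)"
    and lim: "((\<lambda>t. jpowr (h t) (1 / t)) \<longlongrightarrow>
           jexp ((1 - l) *\<^sub>R vector_derivative g1 (at 0) + l *\<^sub>R vector_derivative g2 (at 0))) (at 0)"
    using S l e g unfolding lie_trotter_2mean_def h_def by blast+
  have h: "h t \<in> pos_cone" if "t \<in> ?I" for t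
    using mean l cone[OF that] unfolding weighted_2mean_def h_def by blast
  have h0: "h 0 = 1"
  proof -
    have "(1::'a) \<in> pos_cone" using cone(1)[of 0] one e by simp
    then show ?thesis using mean l one unfolding weighted_2mean_def h_def by simp
  qed
  have "h differentiable_on ?I"
    unfolding differentiable_on_def
  proof
    fix t assume t: "t \<in> ?I"
    obtain D1 D2 where "(g1 has_derivative D1) (at t within ?I)" "(g2 has_derivative D2) (at t within ?I)"
      using g t unfolding cone_curve_def differentiable_on_def differentiable_def by blast
    then have "(\<lambda>t. (g1 t, g2 t)) differentiable (at t within ?I)"
      unfolding differentiable_def by (intro exI) (rule has_derivative_Pair)
    moreover have "(\<lambda>(A, B). S2 (1 - l) l A B) differentiable
        (at (g1 t, g2 t) within (\<lambda>t. (g1 t, g2 t)) ` ?I)"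
      using diff cone t unfolding differentiable_on_def
      by (blast intro: differentiable_within_subset)
    ultimately have "(\<lambda>(A, B). S2 (1 - l) l A B) \<circ> (\<lambda>t. (g1 t, g2 t)) differentiable (at t within ?I)"
      by (rule differentiable_chain_within)
    then show "h differentiable (at t within ?I)" by (simp add: o_def h_def[abs_def])
  qed
  then have curve: "cone_curve \<epsilon> h" using h h0 by (simp add: cone_curve_def)
  have "((\<lambda>t. jpowr (h t) (1 / t)) \<longlongrightarrow> jexp (vector_derivative h (at 0))) (at 0)"
    by (rule tendsto_jpowr_curve[OF cone_curve_has_vector_derivative[OF curve e] h0])
  then have "jexp (vector_derivative h (at 0))
      = jexp ((1 - l) *\<^sub>R vector_derivative g1 (at 0) + l *\<^sub>R vector_derivative g2 (at 0))"
    by (rule tendsto_unique[OF at_neq_bot _ lim])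
  then have "vector_derivative h (at 0) = (1 - l) *\<^sub>R vector_derivative g1 (at 0) + l *\<^sub>R vector_derivative g2 (at 0)"
    by (rule jexp_inj)
  then show ?thesis using curve unfolding h_def[abs_def] by simp
qed

section \<open>Sagae-Tanabe means\<close>

lemma prob_simplex_2:
  assumes "\<omega> \<in> prob_simplex 2"
  shows "\<omega> 1 = 1 - \<omega> 2" "\<omega> 2 \<in> {0<..<1}"
proof -
  have "{1..2::nat} = {1, 2}" by auto
  then show "\<omega> 1 = 1 - \<omega> 2" "\<omega> 2 \<in> {0<..<1}" using assms by (auto simp: prob_simplex_def)
qed

lemma prob_simplex_Suc:
  assumes "\<omega> \<in> prob_simplex (Suc n)" "n \<ge> 1"
  shows "\<omega> (Suc n) \<in> {0<..<1}" "(\<lambda>k. \<omega> k / (1 - \<omega> (Suc n))) \<in> prob_simplex n"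
proof -
  have pos: "\<omega> k > 0" if "k \<in> {1..Suc n}" for k using assms(1) that by (simp add: prob_simplex_def)
  have sum: "(\<Sum>k=1..n. \<omega> k) = 1 - \<omega> (Suc n)"
    using assms(1) by (simp add: prob_simplex_def)
  have "(\<Sum>k=1..n. \<omega> k) > 0" using assms(2) pos by (intro sum_pos) auto
  then have lt: "\<omega> (Suc n) < 1" using sum by simp
  then show "\<omega> (Suc n) \<in> {0<..<1}" using pos[of "Suc n"] by simp
  have "(\<Sum>k=1..n. \<omega> k / (1 - \<omega> (Suc n))) = 1"
    using sum lt by (simp flip: sum_divide_distrib)
  then show "(\<lambda>k. \<omega> k / (1 - \<omega> (Suc n))) \<in> prob_simplex n"
    using pos lt by (simp add: prob_simplex_def)
qed

lemma sagae_tanabe_2: "sagae_tanabe S 2 \<omega> A = S (\<omega> 1) (\<omega> 2) (A 1) (A 2)"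
  by (simp add: sagae_tanabe.simps)

lemma sagae_tanabe_Suc:
  "n \<ge> 2 \<Longrightarrow> sagae_tanabe S (Suc n) \<omega> A =
     S (1 - \<omega> (Suc n)) (\<omega> (Suc n)) (sagae_tanabe S n (\<lambda>k. \<omega> k / (1 - \<omega> (Suc n))) A) (A (Suc n))"
  by (subst sagae_tanabe.simps) simp

lemma sagae_tanabe_cong:
  assumes "n \<ge> 2" "\<And>k. k \<in> {1..n} \<Longrightarrow> \<omega> k = \<omega>' k \<and> A k = A' k"
  shows "sagae_tanabe S n \<omega> A = sagae_tanabe S n \<omega>' A'"
  using assms
proof (induction n arbitrary: \<omega> \<omega>' rule: nat_induct_at_least)
  case base
  then show ?case by (simp add: sagae_tanabe_2)
next
  case (Suc n)
  have "sagae_tanabe S n (\<lambda>k. \<omega> k / (1 - \<omega> (Suc n))) A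
      = sagae_tanabe S n (\<lambda>k. \<omega>' k / (1 - \<omega>' (Suc n))) A'"
    using Suc.prems by (intro Suc.IH) auto
  then show ?case using Suc.prems Suc.hyps by (simp add: sagae_tanabe_Suc)
qed

lemma sagae_tanabe_in_pos_cone:
  assumes S: "weighted_2mean S2" and "n \<ge> 2" "\<omega> \<in> prob_simplex n" "\<And>k. k \<in> {1..n} \<Longrightarrow> A k \<in> pos_cone"
  shows "sagae_tanabe S2 n \<omega> A \<in> pos_cone"
  using assms(2-)
proof (induction n arbitrary: \<omega> rule: nat_induct_at_least)
  case base
  then show ?case using S prob_simplex_2[OF base(1)]
    by (simp add: sagae_tanabe_2 weighted_2mean_def)
next
  case (Suc n)
  have "n \<ge> 1" using Suc.hyps by simp
  note w = prob_simplex_Suc[OF Suc.prems(1) this]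
  have "sagae_tanabe S2 n (\<lambda>k. \<omega> k / (1 - \<omega> (Suc n))) A \<in> pos_cone"
    using Suc.prems w by (intro Suc.IH) auto
  then show ?case using S Suc.prems(2) w(1) Suc.hyps
    by (simp add: sagae_tanabe_Suc weighted_2mean_def)
qed

lemma sagae_tanabe_const:
  assumes S: "weighted_2mean S2" and A: "A \<in> pos_cone" and "n \<ge> 2" "\<omega> \<in> prob_simplex n"
  shows "sagae_tanabe S2 n \<omega> (\<lambda>k. A) = A"
  using assms(3-)
proof (induction n arbitrary: \<omega> rule: nat_induct_at_least)
  case base
  then show ?case using S A prob_simplex_2[OF base(1)]
    by (simp add: sagae_tanabe_2 weighted_2mean_def)
next
  case (Suc n)
  have "n \<ge> 1" using Suc.hyps by simp
  note w = prob_simplex_Suc[OF Suc.prems(1) this]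
  then show ?case using S A Suc.hyps Suc.IH[OF w(2)]
    by (simp add: sagae_tanabe_Suc weighted_2mean_def)
qed

text \<open>
  Induction on \<open>n\<close>: the mean of the first \<open>n\<close> curves is itself a curve to which the two-variable
  formula applies, and the factor \<open>1 - \<omega>\<^sub>n\<^sub>+\<^sub>1\<close> cancels the renormalization of the first \<open>n\<close> weights.
\<close>
lemma sagae_tanabe_curve:
  assumes S: "lie_trotter_2mean S2" and e: "\<epsilon> > 0"
    and "n \<ge> 2" "\<omega> \<in> prob_simplex n" "\<And>k. k \<in> {1..n} \<Longrightarrow> cone_curve \<epsilon> (\<gamma> k)"
  shows "cone_curve \<epsilon> (\<lambda>t. sagae_tanabe S2 n \<omega> (\<lambda>k. \<gamma> k t)) \<and>
    vector_derivative (\<lambda>t. sagae_tanabe S2 n \<omega> (\<lambda>k. \<gamma> k t)) (at 0)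
      = (\<Sum>k=1..n. \<omega> k *\<^sub>R vector_derivative (\<gamma> k) (at 0))"
  using assms(3-)
proof (induction n arbitrary: \<omega> rule: nat_induct_at_least)
  case base
  have "{1..2::nat} = {1, 2}" by auto
  then show ?case using lie_trotter_2mean_curve[OF S prob_simplex_2(2)[OF base(1)] e base(2) base(2), of 1 2]
      prob_simplex_2(1)[OF base(1)]
    by (simp add: sagae_tanabe_2)
next
  case (Suc n)
  have "n \<ge> 1" using Suc.hyps by simp
  note w = prob_simplex_Suc[OF Suc.prems(1) this]
  let ?w = "\<lambda>k. \<omega> k / (1 - \<omega> (Suc n))"
  let ?g = "\<lambda>t. sagae_tanabe S2 n ?w (\<lambda>k. \<gamma> k t)"
  have IH: "cone_curve \<epsilon> ?g"
    "vector_derivative ?g (at 0) = (\<Sum>k=1..n. ?w k *\<^sub>R vector_derivative (\<gamma> k) (at 0))"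
    using Suc.IH[OF w(2)] Suc.prems(2) by auto
  have "(1 - \<omega> (Suc n)) *\<^sub>R (\<Sum>k=1..n. ?w k *\<^sub>R vector_derivative (\<gamma> k) (at 0))
      = (\<Sum>k=1..n. \<omega> k *\<^sub>R vector_derivative (\<gamma> k) (at 0))"
    unfolding scaleR_sum_right using w(1) by (intro sum.cong) auto
  moreover have "cone_curve \<epsilon> (\<gamma> (Suc n))" using Suc.prems(2) by simp
  ultimately show ?case using lie_trotter_2mean_curve[OF S w(1) e IH(1), of "\<gamma> (Suc n)"] Suc.hyps
    by (simp add: IH(2) sagae_tanabe_Suc)
qed

theorem theorem4p4:
  fixes S2 :: "real \<Rightarrow> real \<Rightarrow> 'a::unital_jb_algebra \<Rightarrow> 'a \<Rightarrow> 'a" and n :: nat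
  assumes "lie_trotter_2mean S2" and "n \<ge> 2"
  shows "lie_trotter_mean n (sagae_tanabe S2 n)"
  unfolding lie_trotter_mean_def
proof (intro conjI ballI allI impI)
  have S: "weighted_2mean S2" using assms(1) by (simp add: lie_trotter_2mean_def)
  show "weighted_mean n (sagae_tanabe S2 n)"
    unfolding weighted_mean_def
    using sagae_tanabe_cong[OF assms(2)] sagae_tanabe_in_pos_cone[OF S assms(2)]
      sagae_tanabe_const[OF S _ assms(2)]
    by blast
next
  fix \<omega> \<epsilon> and \<gamma> :: "nat \<Rightarrow> real \<Rightarrow> 'a"
  assume w: "\<omega> \<in> prob_simplex n" and e: "0 < \<epsilon>" and g: "\<forall>k\<in>{1..n}. cone_curve \<epsilon> (\<gamma> k)"
  let ?g = "\<lambda>t. sagae_tanabe S2 n \<omega> (\<lambda>k. \<gamma> k t)"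
  have c: "cone_curve \<epsilon> ?g"
    "vector_derivative ?g (at 0) = (\<Sum>k=1..n. \<omega> k *\<^sub>R vector_derivative (\<gamma> k) (at 0))"
    using sagae_tanabe_curve[OF assms(1) e assms(2) w, of \<gamma>] g by auto
  have "?g 0 = 1" using c(1) by (simp add: cone_curve_def)
  with cone_curve_has_vector_derivative[OF c(1) e]
  have "((\<lambda>t. jpowr (?g t) (1 / t)) \<longlongrightarrow> jexp (vector_derivative ?g (at 0))) (at 0)"
    by (rule tendsto_jpowr_curve)
  then show "((\<lambda>t. jpowr (?g t) (1 / t)) \<longlongrightarrow>
      jexp (\<Sum>k=1..n. \<omega> k *\<^sub>R vector_derivative (\<gamma> k) (at 0))) (at 0)"
    by (simp only: c(2))
qed

end
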